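(* Let $X_1, X_2, \dots, X_n$ be $n$ independent real random variables with $\mathbb{E}[X_i] = 0$ and $X_i \ge -1$ for each $i$, and let $X = \sum_{i=1}^n X_i$. Then $$\text{Prob}[X \le 1] \ge 0.1798.$$
   Context: $\text{Prob}$ denotes probability and $\mathbb{E}$ denotes expectation. The number $n$ of random variables is an arbitrary positive integer, and the random variables are not assumed to be identically distributed. *)

theory Defs
  imports "HOL-Probability.Probability"
begin

end

theory Submission
  imports Defs
begin

text \<open>
  Fix a scale \<open>R\<close> and reweight every \<open>X\<^sub>i\<close> by a cut-off \<open>w\<close> that kills values above \<open>R - 1\<close>. This costs a factor
  \<open>\<Prod> E w(X\<^sub>i) \<ge> exp (- D / R)\<close>, where \<open>1 - D\<close> is the mean of the sum of the reweighted variables, which now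
  have range \<open>R\<close>. Let \<open>V\<close> be the variance of that sum. By continuity there is an \<open>R\<close> with
  \<open>D \<le> 0.65 R\<close> and \<open>V \<le> 1.4 R\<^sup>2\<close>, one of the two being an equality.
  If \<open>D = 0.65 R\<close> and \<open>V \<le> 0.8 R\<^sup>2\<close>, Cantelli's inequality suffices. Otherwise the variance is
  comparable to \<open>R\<^sup>2\<close>, so the characteristic function at the frequency \<open>2 \<pi> / (3 R)\<close> has modulus at
  most \<open>exp (- 3 V / (2 R\<^sup>2))\<close>, and integrating a minorant of the indicator of \<open>{..1}\<close>
  built from a quadratic and that frequency gives the bound.
\<close>

subsection \<open>The test function\<close>

lemma sum_lessThan_8: "(\<Sum>m<8. f m) = f 0 + f 1 + f 2 + f 3 + f 4 + f 5 + f 6 + f (7::nat)" for f :: "nat \<Rightarrow> real"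
proof -
  have "{..<8::nat} = {0,1,2,3,4,5,6,7}" by auto
  thus ?thesis by simp
qed

lemma cos_ge_quadratic: "1 - z\<^sup>2 / 2 \<le> cos z" for z :: real
proof -
  have "(sin (z / 2))\<^sup>2 \<le> (z / 2)\<^sup>2"
    using abs_sin_x_le_abs_x[of "z / 2"] by (simp only: abs_le_square_iff)
  thus ?thesis using cos_double_sin[of "z / 2"] by (simp add: power_divide)
qed

text \<open>Since \<open>sin (pi/6) = 1/2\<close> and the sine increases on the relevant range,
  comparing its Taylor value at \<open>0.5235 = 3.141/6\<close> with \<open>1/2\<close> decides on
  which side \<open>pi/6\<close> lies. The upper bound is obtained in the same way.\<close>

lemma pi_gt: "pi > 3141/1000"
proof (rule ccontr)
  assume "\<not> pi > 3141/1000"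
  hence *: "pi / 6 \<le> 0.5235" by simp
  have "sin (pi/6) \<le> sin (0.5235::real)"
    using * pi_gt3 by (intro sin_monotone_2pi_le) auto
  moreover have "\<bar>sin (0.5235::real) - (\<Sum>m<8. sin_coeff m * 0.5235 ^ m)\<bar> \<le> inverse (fact 8) * \<bar>0.5235\<bar> ^ 8"
    by (rule Maclaurin_sin_bound)
  hence "sin (0.5235::real) < 1/2"
    unfolding abs_le_iff by (simp add: sum_lessThan_8 sin_coeff_def fact_numeral field_simps)
  ultimately show False by (simp add: sin_30)
qed

lemma pi_lt: "pi < 3142/1000"
proof (rule ccontr)
  assume "\<not> pi < 3142/1000"
  hence *: "pi / 6 \<ge> 0.52366" by simp
  have "sin (pi/6) \<ge> sin (0.52366::real)"
    using * pi_gt3 pi_less_4 by (intro sin_monotone_2pi_le) auto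
  moreover have "\<bar>sin (0.52366::real) - (\<Sum>m<8. sin_coeff m * 0.52366 ^ m)\<bar> \<le> inverse (fact 8) * \<bar>0.52366\<bar> ^ 8"
    by (rule Maclaurin_sin_bound)
  hence "sin (0.52366::real) > 1/2"
    unfolding abs_le_iff by (simp add: sum_lessThan_8 sin_coeff_def fact_numeral field_simps)
  ultimately show False by (simp add: sin_30)
qed

lemma sin_ge_chord:
  fixes x y :: real
  assumes "0 \<le> x" "x \<le> y" "0 < y" "y \<le> pi"
  shows "x / y * sin y \<le> sin x"
proof -
  have "concave_on {0..pi} (sin :: real \<Rightarrow> real)"
    by (rule f''_le0_imp_concave[where f' = cos and f'' = "\<lambda>x. - sin x"])
       (auto intro!: derivative_eq_intros sin_ge_zero)
  from concave_onD[OF this, of "x / y" 0 y] assms show ?thesis by simp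
qed

text \<open>Writing \<open>1 - cos u\<close> as twice a squared sine of the half angle reduces this
  to the chord bound for the sine. It serves to turn cosines of differences into variances and to
  bound the test function near its peaks.\<close>

lemma one_minus_cos_ge:
  fixes t u :: real
  assumes "0 < t" "t \<le> pi" "\<bar>u\<bar> \<le> t"
  shows "(1 - cos t) * (u / t)\<^sup>2 \<le> 1 - cos u"
proof -
  have half: "1 - cos v = 2 * (sin (\<bar>v\<bar> / 2))\<^sup>2" for v :: real
    using cos_double_sin[of "\<bar>v\<bar> / 2"] by simp
  have "\<bar>u\<bar> / t * sin (t / 2) \<le> sin (\<bar>u\<bar> / 2)"
    using sin_ge_chord[of "\<bar>u\<bar> / 2" "t / 2"] assms by simp
  moreover have "0 \<le> \<bar>u\<bar> / t * sin (t / 2)"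
    using assms by (intro mult_nonneg_nonneg divide_nonneg_nonneg sin_ge_zero) auto
  ultimately have "(\<bar>u\<bar> / t * sin (t / 2))\<^sup>2 \<le> (sin (\<bar>u\<bar> / 2))\<^sup>2"
    by (intro power_mono)
  thus ?thesis using assms
    by (simp add: half power_mult_distrib power_divide mult_ac)
qed

text \<open>The test function \<^term>\<open>test_fun\<close>, divided by \<open>4.23\<close>, lies below the indicator of
  \<open>s < -11/4\<close>. It is a quadratic plus a single frequency, so its expectation depends only on mean,
  variance and one value of the characteristic function. The form comes from a numerical
  optimisation over all such functions: touching the \<open>s\<close>-axis from below at \<open>s = 0\<close>
  and (nearly) at \<open>s = -11/4\<close>.\<close>

definition test_fun :: "real \<Rightarrow> real" where
  "test_fun s = cos s + sin s - 1 - s - 59/1000 * s\<^sup>2"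

section \<open>The test function: phase form, sign and maximum\<close>

lemma sqrt2_cancel: "sqrt 2 * (x * sqrt 2) = 2 * x" "sqrt 2 * (sqrt 2 * x) = 2 * x" for x :: real
proof -
  have "sqrt 2 * (sqrt 2 * x) = (sqrt 2 * sqrt 2) * x" by (simp only: mult.assoc)
  thus *: "sqrt 2 * (sqrt 2 * x) = 2 * x" by simp
  thus "sqrt 2 * (x * sqrt 2) = 2 * x" by (simp only: mult.commute)
qed

text \<open>Merging both terms into one shifted cosine is what lets a single value of the
  characteristic function control them.\<close>

lemma cos_add_sin: "cos s + sin s = sqrt 2 * cos (s - pi/4)" for s :: real
  by (simp add: cos_diff cos_45 sin_45 algebra_simps sqrt2_cancel)

lemma sqrt2_bounds: "14142/10000 < sqrt 2" "sqrt 2 < 14143/10000"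
proof -
  have "sqrt ((14142/10000)\<^sup>2) < sqrt 2" "sqrt 2 < sqrt ((14143/10000)\<^sup>2)"
    unfolding real_sqrt_less_iff by (simp_all add: power2_eq_square)
  thus "14142/10000 < sqrt 2" "sqrt 2 < 14143/10000" by simp_all
qed

text \<open>The square is \<open>1 + 2 * sin s * cos s\<close>. This supplies the sign of the first
  derivative of the test function on one interval and of the second derivative on the next.\<close>

lemma sin_add_cos_ge_1:
  fixes s :: real
  assumes "0 \<le> s" "s \<le> pi/2"
  shows "1 \<le> sin s + cos s"
proof -
  have sc: "0 \<le> sin s" "0 \<le> cos s"
    using assms pi_gt3 by (auto intro!: sin_ge_zero cos_ge_zero)
  have "(sin s + cos s)\<^sup>2 = (sin s)\<^sup>2 + (cos s)\<^sup>2 + 2 * (sin s * cos s)"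
    by (simp only: power2_sum mult.assoc)
  also have "\<dots> = 1 + 2 * (sin s * cos s)" by (simp only: sin_cos_squared_add)
  finally have "1 \<le> (sin s + cos s)\<^sup>2" using mult_nonneg_nonneg[OF sc] by linarith
  hence "1\<^sup>2 \<le> (sin s + cos s)\<^sup>2" by (simp only: one_power2)
  thus ?thesis using sc by (intro power2_le_imp_le[of 1 "sin s + cos s"]) linarith+
qed

text \<open>After \<open>w = - s\<close>, the function decreases from 0 on \<open>[0, pi/2]\<close>
  and is convex on \<open>[pi/2, 11/4]\<close>, so on the second interval only the endpoints
  matter.\<close>

lemma test_fun_nonpos:
  assumes "s \<ge> - 11/4"
  shows "test_fun s \<le> 0"
proof (cases "s \<ge> 0")
  case True
  have "sin s \<le> s" using True by (rule sin_x_le_x)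
  moreover have "0 \<le> 59/1000 * s\<^sup>2" by simp
  ultimately show ?thesis using cos_le_one[of s] unfolding test_fun_def by linarith
next
  case False
  define w where "w = - s"
  define g where "g w = cos w - sin w - 1 + w - 59/1000 * w\<^sup>2" for w :: real
  have Hg: "test_fun s = g w" by (simp add: test_fun_def g_def w_def)
  have w: "0 \<le> w" "w \<le> 11/4" using False assms by (auto simp: w_def)
  have der: "(g has_real_derivative (- sin w - cos w + 1 - 118/1000 * w)) (at w)" for w
    unfolding g_def by (auto intro!: derivative_eq_intros)
  have small: "g x \<le> 0" if "0 \<le> x" "x \<le> pi/2" for x
  proof -
    have "g x \<le> g 0"
    proof (rule DERIV_nonpos_imp_nonincreasing[OF that(1)])
      fix y assume y: "0 \<le> y" "y \<le> x"
      have "1 \<le> sin y + cos y" using y that by (intro sin_add_cos_ge_1) auto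
      thus "\<exists>z. DERIV g y :> z \<and> z \<le> 0"
        using der[of y] y(1) by (intro exI[of _ "- sin y - cos y + 1 - 118/1000 * y"] conjI) simp_all
    qed
    thus ?thesis by (simp add: g_def)
  qed
  have "g w \<le> 0"
  proof (cases "w \<le> pi/2")
    case True thus ?thesis using small w by auto
  next
    case False
    have conv: "convex_on {pi/2..11/4} g"
    proof (rule f''_ge0_imp_convex[where f' = "\<lambda>w. - sin w - cos w + 1 - 118/1000 * w" and f'' = "\<lambda>w. - cos w + sin w - 118/1000"])
      fix x :: real assume x: "x \<in> {pi/2..11/4}"
      \<comment> \<open>A shift by \<open>pi/2\<close> turns the oscillating part of the second
        derivative into the sum bounded earlier; \<open>11/4 < pi\<close> keeps the shifted argument
        in the first quadrant.\<close>
      have "1 \<le> sin (x - pi/2) + cos (x - pi/2)"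
        using x pi_gt by (intro sin_add_cos_ge_1) auto
      thus "0 \<le> - cos x + sin x - 118/1000" by (simp add: sin_diff cos_diff)
    next
      show "((\<lambda>w. - sin w - cos w + 1 - 118/1000 * w) has_real_derivative - cos x + sin x - 118/1000) (at x)" for x
        by (auto intro!: derivative_eq_intros)
    next
      show "(g has_real_derivative - sin x - cos x + 1 - 118/1000 * x) (at x)" for x
        by (rule der)
    qed simp
    have c135: "cos (3*pi/4) = - sqrt 2 / 2" "sin (3*pi/4) = sqrt 2 / 2"
      using cos_add[of "pi/2" "pi/4"] sin_add[of "pi/2" "pi/4"] by (simp_all add: cos_45 sin_45 field_simps)
    \<comment> \<open>At \<open>3*pi/4\<close> the difference \<open>sin - cos\<close> peaks, and
      \<open>11/4\<close> is only about 0.394 away, so a quadratic bound on the cosine suffices.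
      There is little room: \<open>g (11/4)\<close> is about -0.002.\<close>
    define z where "z = 11/4 - 3 * pi / 4"
    have "- cos (11/4 :: real) + sin (11/4) = sqrt 2 * cos z"
      unfolding z_def cos_diff c135 by (simp add: algebra_simps sqrt2_cancel)
    moreover have "cos z \<ge> 1 - z\<^sup>2 / 2"
      by (rule cos_ge_quadratic)
    moreover have "\<bar>z\<bar> \<le> 3943/10000" using pi_gt pi_lt by (simp add: z_def)
    hence "z\<^sup>2 \<le> (3943/10000)\<^sup>2" using power_mono[of "\<bar>z\<bar>" "3943/10000" 2] by simp
    ultimately have "- cos (11/4 :: real) + sin (11/4) \<ge> 1304/1000"
      using sqrt2_bounds mult_mono[of "14142/10000" "sqrt 2" "9222/10000" "cos z"] by (simp add: power2_eq_square)
    hence "g (11/4) \<le> 0" by (simp add: g_def power2_eq_square)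
    hence "max (g (pi/2)) (g (11/4)) \<le> 0" using small[of "pi/2"] by simp
    moreover have "g w \<le> max (g (pi/2)) (g (11/4))"
      using convex_on_le_max[OF conv, of w] False w by auto
    ultimately show ?thesis by linarith
  qed
  thus ?thesis by (simp add: Hg)
qed

text \<open>After \<open>w = - s\<close>, the cosine is replaced by a downward parabola around its
  peaks at \<open>7*pi/4\<close> and \<open>15*pi/4\<close>, which leaves a quadratic to maximise.
  Outside these windows \<open>cos \<le> 1\<close> is enough.\<close>

lemma test_fun_le: "test_fun s \<le> 423/100"
proof -
  define w where "w = - s"
  have Hw: "test_fun s = sqrt 2 * cos (w + pi/4) - 1 + w - 59/1000 * w\<^sup>2"
    using cos_add_sin[of s] cos_minus[of "w + pi/4"] by (simp add: test_fun_def w_def)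
  \<comment> \<open>The coefficient \<open>0.28\<close> is below \<open>2 * sqrt 2 / pi^2\<close>,
    which the quadratic cosine bound gives over a full half period \<open>pi\<close>.\<close>
  have window: "sqrt 2 * cos (w + pi/4) \<le> 14143/10000 - 28/100 * (w - c)\<^sup>2"
    if "cos (w + pi/4) = cos (w - c)" "\<bar>w - c\<bar> \<le> pi" for c
  proof -
    have "2 * ((w - c) / pi)\<^sup>2 \<le> 1 - cos (w - c)"
      using one_minus_cos_ge[of pi "w - c"] that by simp
    hence "sqrt 2 * cos (w - c) \<le> sqrt 2 * (1 - 2 * ((w - c) / pi)\<^sup>2)" by simp
    moreover have "pi\<^sup>2 \<le> (3142/1000)\<^sup>2" using pi_lt pi_gt3 by (intro power_mono) auto
    hence "(w - c)\<^sup>2 * (1 / (3142/1000)\<^sup>2) \<le> (w - c)\<^sup>2 * (1 / pi\<^sup>2)"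
      by (intro mult_left_mono divide_left_mono) auto
    hence "((w - c) / pi)\<^sup>2 \<ge> (w - c)\<^sup>2 * (1 / (3142/1000)\<^sup>2)" by (simp add: power_divide)
    hence "14142/10000 * (2 * ((w - c)\<^sup>2 * (1 / (3142/1000)\<^sup>2))) \<le> sqrt 2 * (2 * ((w - c) / pi)\<^sup>2)"
      using sqrt2_bounds by (intro mult_mono) auto
    moreover have "28/100 * (w - c)\<^sup>2 \<le> 14142/10000 * (2 * ((w - c)\<^sup>2 * (1 / (3142/1000)\<^sup>2)))"
      by (simp add: power2_eq_square)
    ultimately show ?thesis using sqrt2_bounds that(1) by (simp add: algebra_simps)
  qed
  have triv: "test_fun s \<le> 4143/10000 + w - 59/1000 * w\<^sup>2"
    unfolding Hw using sqrt2_bounds mult_left_mono[OF cos_le_one[of "w + pi/4"], of "sqrt 2"] by linarith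
  consider "w \<le> 3*pi/4" | "3*pi/4 \<le> w" "w \<le> 11*pi/4" | "11*pi/4 \<le> w" "w \<le> 15*pi/4" | "15*pi/4 \<le> w" by linarith
  thus ?thesis
  proof cases
    case 1
    have "0 \<le> 59/1000 * w\<^sup>2" by simp
    thus ?thesis using triv 1 pi_lt by linarith
  next
    case 2
    define z where "z = w - 7*pi/4"
    have "cos (w + pi/4) = cos (w - 7*pi/4)"
      using cos_periodic[of "w - 7*pi/4"] by (simp add: algebra_simps)
    from window[OF this] 2 have "test_fun s \<le> 4143/10000 - 28/100 * z\<^sup>2 + w - 59/1000 * w\<^sup>2"
      by (simp add: Hw z_def abs_le_iff)
    \<comment> \<open>\<open>11/2\<close> is a decimal stand-in for \<open>7*pi/4\<close>, and
      \<open>d\<close> is the rounding error.\<close>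
    moreover define d where "d = 7*pi/4 - 11/2"
    have w: "w = z + d + 11/2" by (simp add: z_def d_def)
    moreover have "\<bar>d\<bar> \<le> 1/250" "\<bar>z\<bar> \<le> 4"
      using 2 pi_gt pi_lt unfolding d_def z_def by linarith+
    hence "z * d \<ge> - (4/250)" "d \<le> 1/250"
      using mult_mono[of "\<bar>z\<bar>" 4 "\<bar>d\<bar>" "1/250"] by (auto simp: abs_le_iff simp flip: abs_mult)
    \<comment> \<open>\<open>351/678\<close> maximises \<open>0.351 * z - 0.339 * z^2\<close>, the
      quadratic left after collecting terms. The second window uses the same completion of the
      square for \<open>- 0.39004 * z - 0.339 * z^2\<close>.\<close>
    moreover have "0 \<le> (z - 351/678)\<^sup>2" "0 \<le> d\<^sup>2" by simp_all
    moreover have "59/1000 * w\<^sup>2 = 59/1000 * z\<^sup>2 + 118/1000 * (z * d) + 59/1000 * d\<^sup>2 + 649/1000 * z + 649/1000 * d + 7139/4000"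
      "(z - 351/678)\<^sup>2 = z\<^sup>2 - 351/339 * z + 123201/459684"
      by (simp_all add: w power2_eq_square algebra_simps)
    ultimately show ?thesis by linarith
  next
    case 3
    define z where "z = w - 15*pi/4"
    have "cos (w + pi/4) = cos (w - 15*pi/4)"
      using cos_periodic[of "w - 15*pi/4"] cos_periodic[of "w - 7*pi/4"] by (simp add: algebra_simps)
    from window[OF this] 3 have "test_fun s \<le> 4143/10000 - 28/100 * z\<^sup>2 + w - 59/1000 * w\<^sup>2"
      by (simp add: Hw z_def abs_le_iff)
    moreover define d where "d = 15*pi/4 - 1178/100"
    have w: "w = z + d + 1178/100" by (simp add: z_def d_def)
    moreover have "\<bar>d\<bar> \<le> 1/250" "\<bar>z\<bar> \<le> 4"
      using 3 pi_gt pi_lt unfolding d_def z_def by linarith+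
    hence "z * d \<ge> - (4/250)" "d \<ge> - 1/250"
      using mult_mono[of "\<bar>z\<bar>" 4 "\<bar>d\<bar>" "1/250"] by (auto simp: abs_le_iff simp flip: abs_mult)
    moreover have "0 \<le> (z + 39004/67800)\<^sup>2" "0 \<le> d\<^sup>2" by simp_all
    moreover have "59/1000 * w\<^sup>2 = 59/1000 * z\<^sup>2 + 118/1000 * (z * d) + 59/1000 * d\<^sup>2 + 139004/100000 * z + 139004/100000 * d + 81873356/10000000"
      "(z + 39004/67800)\<^sup>2 = z\<^sup>2 + 39004/33900 * z + 1521312016/4596840000"
      by (simp_all add: w power2_eq_square algebra_simps)
    ultimately show ?thesis by linarith
  next
    case 4
    \<comment> \<open>Replacing \<open>w^2\<close> by its tangent at 11 makes the bound affine and
      decreasing in \<open>w\<close>.\<close>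
    have "0 \<le> (w - 11)\<^sup>2" by simp
    thus ?thesis using triv 4 pi_gt by (simp add: power2_eq_square algebra_simps)
  qed
qed

subsection \<open>Sums of independent variables of bounded range\<close>

lemma (in prob_space) second_moment_indep_sum:
  fixes Y :: "'i \<Rightarrow> 'a \<Rightarrow> real"
  assumes "finite I" "indep_vars (\<lambda>_. borel) Y I"
    and "\<And>i. i \<in> I \<Longrightarrow> integrable M (\<lambda>\<omega>. (Y i \<omega>)\<^sup>2)"
  shows "integrable M (\<lambda>\<omega>. (\<Sum>i\<in>I. Y i \<omega>)\<^sup>2)
    \<and> expectation (\<lambda>\<omega>. (\<Sum>i\<in>I. Y i \<omega>)\<^sup>2)
       = (\<Sum>i\<in>I. expectation (\<lambda>\<omega>. (Y i \<omega>)\<^sup>2) - (expectation (Y i))\<^sup>2) + (\<Sum>i\<in>I. expectation (Y i))\<^sup>2"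
  using assms
proof (induction I rule: finite_induct)
  case empty
  show ?case by simp
next
  case (insert i I)
  have rv: "random_variable borel (Y j)" if "j \<in> insert i I" for j
    using insert.prems(1) that by (auto simp: indep_vars_def2)
  have int: "integrable M (Y j)" if "j \<in> insert i I" for j
    using square_integrable_imp_integrable[OF rv[OF that] insert.prems(2)[OF that]] .
  have IH: "integrable M (\<lambda>\<omega>. (\<Sum>i\<in>I. Y i \<omega>)\<^sup>2)"
    "expectation (\<lambda>\<omega>. (\<Sum>i\<in>I. Y i \<omega>)\<^sup>2)
       = (\<Sum>i\<in>I. expectation (\<lambda>\<omega>. (Y i \<omega>)\<^sup>2) - (expectation (Y i))\<^sup>2) + (\<Sum>i\<in>I. expectation (Y i))\<^sup>2"
    using insert.IH indep_vars_subset[OF insert.prems(1)] insert.prems(2) by auto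
  have iv: "indep_var borel (Y i) borel (\<lambda>\<omega>. \<Sum>i\<in>I. Y i \<omega>)"
    using insert by (intro indep_vars_sum) auto
  have intS: "integrable M (\<lambda>\<omega>. \<Sum>i\<in>I. Y i \<omega>)" using int by auto
  have prod: "integrable M (\<lambda>\<omega>. Y i \<omega> * (\<Sum>i\<in>I. Y i \<omega>))"
    "expectation (\<lambda>\<omega>. Y i \<omega> * (\<Sum>i\<in>I. Y i \<omega>)) = expectation (Y i) * (\<Sum>i\<in>I. expectation (Y i))"
    using indep_var_integrable[OF iv int intS] indep_var_lebesgue_integral[OF iv int intS] int
    by auto
  have eq: "(\<lambda>\<omega>. (\<Sum>j\<in>insert i I. Y j \<omega>)\<^sup>2)
    = (\<lambda>\<omega>. (Y i \<omega>)\<^sup>2 + 2 * (Y i \<omega> * (\<Sum>i\<in>I. Y i \<omega>)) + (\<Sum>i\<in>I. Y i \<omega>)\<^sup>2)"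
    using insert.hyps by (auto simp: power2_sum)
  show ?case unfolding eq
    using IH prod insert.prems(2)[of i] insert.hyps by (auto simp: power2_sum)
qed

text \<open>For independent copies \<open>x\<close>, \<open>y\<close>, the squared modulus is the
  mean of \<open>cos (s * (x - y))\<close>. The range bound keeps the angle within \<open>t\<close>,
  so the quadratic cosine bound applies, and \<open>(x - y)^2\<close> has mean twice the variance.
  Finally \<open>1 - u \<le> exp (- u)\<close> gives a form that multiplies well over
  summands.\<close>

lemma (in real_distribution) cmod_char_le_exp_variance:
  fixes b R t :: real
  assumes R: "0 < R" and t: "0 < t" "t \<le> pi" and bd: "AE x in M. b \<le> x \<and> x \<le> b + R"
  shows "cmod (char M (t / R)) \<le> exp (- (1 - cos t) * (expectation (\<lambda>x. x\<^sup>2) - (expectation (\<lambda>x. x))\<^sup>2) / R\<^sup>2)"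
proof -
  define s where "s = t / R"
  define k where "k = (1 - cos t) / R\<^sup>2"
  define C where "C = expectation (\<lambda>x. cos (s * x))"
  define S where "S = expectation (\<lambda>x. sin (s * x))"
  define m where "m = expectation (\<lambda>x. x)"
  define m2 where "m2 = expectation (\<lambda>x. x\<^sup>2)"
  have [simp]: "prob UNIV = 1" using prob_space by simp
  have int [simp]: "integrable M (\<lambda>x. cos (s * x))" "integrable M (\<lambda>x. sin (s * x))"
    by (auto intro!: integrable_const_bound[where B = 1])
  have int2 [simp]: "integrable M (\<lambda>x. x\<^sup>2)"
  proof (rule integrable_const_bound[where B = "(\<bar>b\<bar> + R)\<^sup>2"])
    show "AE x in M. norm (x\<^sup>2) \<le> (\<bar>b\<bar> + R)\<^sup>2"
      using bd
    proof eventually_elim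
      case (elim x)
      hence "\<bar>x\<bar> \<le> \<bar>\<bar>b\<bar> + R\<bar>" using R by auto
      thus ?case by (simp add: abs_le_square_iff)
    qed
  qed simp
  have int1 [simp]: "integrable M (\<lambda>x. x)"
    by (rule square_integrable_imp_integrable) simp_all
  have key: "k * (x - y)\<^sup>2 \<le> 1 - cos (s * x) * cos (s * y) - sin (s * x) * sin (s * y)"
    if "b \<le> x \<and> x \<le> b + R" "b \<le> y \<and> y \<le> b + R" for x y
  proof -
    have "\<bar>s * (x - y)\<bar> \<le> t"
    proof -
      have "\<bar>x - y\<bar> \<le> R" using that by linarith
      from mult_left_mono[OF this, of s] show ?thesis using R t by (simp add: s_def abs_mult)
    qed
    from one_minus_cos_ge[OF t this]
    have "(1 - cos t) * (s * (x - y) / t)\<^sup>2 \<le> 1 - cos (s * x - s * y)"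
      by (simp add: right_diff_distrib)
    moreover have "(1 - cos t) * (s * (x - y) / t)\<^sup>2 = k * (x - y)\<^sup>2"
      using R t by (simp add: k_def s_def power_divide)
    ultimately show ?thesis by (simp add: cos_diff)
  qed
  \<comment> \<open>Integrating over \<open>y\<close> for fixed \<open>x\<close>, and then over
    \<open>x\<close>, replaces the construction of an independent copy.\<close>
  have inner: "AE x in M. k * (x\<^sup>2 - 2 * x * m + m2) \<le> 1 - cos (s * x) * C - sin (s * x) * S"
    using bd
  proof eventually_elim
    case (elim x)
    have "expectation (\<lambda>y. k * (x\<^sup>2 - 2 * x * y + y\<^sup>2))
      \<le> expectation (\<lambda>y. 1 - cos (s * x) * cos (s * y) - sin (s * x) * sin (s * y))"
    proof (rule integral_mono_AE)
      show "AE y in M. k * (x\<^sup>2 - 2 * x * y + y\<^sup>2) \<le> 1 - cos (s * x) * cos (s * y) - sin (s * x) * sin (s * y)"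
        using bd
      proof eventually_elim
        case (elim y)
        from key[OF \<open>b \<le> x \<and> x \<le> b + R\<close> this] show ?case
          by (simp add: power2_diff algebra_simps)
      qed
    qed simp_all
    moreover have "expectation (\<lambda>y. k * (x\<^sup>2 - 2 * x * y + y\<^sup>2)) = k * (x\<^sup>2 - 2 * x * m + m2)"
      by (simp add: m_def m2_def)
    moreover have "expectation (\<lambda>y. 1 - cos (s * x) * cos (s * y) - sin (s * x) * sin (s * y))
      = 1 - cos (s * x) * C - sin (s * x) * S"
      by (simp add: C_def S_def)
    ultimately show ?case by (simp only:)
  qed
  have "expectation (\<lambda>x. k * (x\<^sup>2 - 2 * x * m + m2)) \<le> expectation (\<lambda>x. 1 - cos (s * x) * C - sin (s * x) * S)"
    by (rule integral_mono_AE[OF _ _ inner]) simp_all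
  hence "k * (m2 - 2 * m * m + m2) \<le> 1 - C * C - S * S"
    by (simp add: C_def[symmetric] S_def[symmetric] m_def[symmetric] m2_def[symmetric])
  hence CS: "C\<^sup>2 + S\<^sup>2 \<le> 1 - 2 * k * (m2 - m\<^sup>2)"
    by (simp add: power2_eq_square algebra_simps)
  have "char M s = Complex C S"
  proof (rule complex_eqI)
    have i: "integrable M (\<lambda>x. iexp (s * x))"
      by (intro integrable_const_bound[where B = 1]) auto
    show "Re (char M s) = Re (Complex C S)" "Im (char M s) = Im (Complex C S)"
      unfolding char_def integral_Re[OF i, symmetric] integral_Im[OF i, symmetric]
      by (simp_all add: C_def S_def Re_exp Im_exp)
  qed
  hence "(cmod (char M s))\<^sup>2 \<le> 1 - 2 * k * (m2 - m\<^sup>2)" using CS by (simp add: cmod_power2)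
  also have "\<dots> \<le> exp (- (2 * k * (m2 - m\<^sup>2)))"
    using exp_ge_add_one_self[of "- (2 * k * (m2 - m\<^sup>2))"] by simp
  also have "\<dots> = (exp (- (k * (m2 - m\<^sup>2))))\<^sup>2"
    by (simp add: power2_eq_square flip: exp_add)
  finally have "cmod (char M s) \<le> exp (- (k * (m2 - m\<^sup>2)))" by (rule power2_le_imp_le) simp
  thus ?thesis
    by (simp only: s_def k_def m_def m2_def minus_mult_left minus_divide_left times_divide_eq_left)
qed

section \<open>Lower bounds for a tail probability from minorants of an indicator\<close>

lemma (in prob_space) expectation_le_prob_atMost:
  fixes S :: "'a \<Rightarrow> real" and f :: "real \<Rightarrow> real"
  assumes [measurable]: "S \<in> borel_measurable M" and "integrable M (\<lambda>\<omega>. f (S \<omega>))"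
    and le1: "\<And>x. f x \<le> 1" and le0: "\<And>x. c < x \<Longrightarrow> f x \<le> 0"
  shows "expectation (\<lambda>\<omega>. f (S \<omega>)) \<le> prob {\<omega> \<in> space M. S \<omega> \<le> c}"
proof -
  have "expectation (\<lambda>\<omega>. f (S \<omega>)) \<le> expectation (indicator {\<omega> \<in> space M. S \<omega> \<le> c})"
  proof (rule integral_mono)
    show "integrable M (indicator {\<omega> \<in> space M. S \<omega> \<le> c} :: 'a \<Rightarrow> real)"
      by (rule integrable_const_bound[where B = 1]) auto
  qed (use assms in \<open>auto simp: indicator_def not_le\<close>)
  thus ?thesis by simp
qed

lemma (in prob_space) cantelli_atMost:
  fixes S :: "'a \<Rightarrow> real"
  assumes [measurable]: "S \<in> borel_measurable M" and int: "integrable M (\<lambda>\<omega>. (S \<omega>)\<^sup>2)"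
    and D: "D = c - expectation S" "0 < D"
    and V: "expectation (\<lambda>\<omega>. (S \<omega>)\<^sup>2) = V + (expectation S)\<^sup>2" "0 \<le> V"
  shows "D\<^sup>2 / (D\<^sup>2 + V) \<le> prob {\<omega> \<in> space M. S \<omega> \<le> c}"
proof -
  \<comment> \<open>The parabola \<open>1 - (x - c + b)^2 / b^2\<close> vanishes at \<open>c\<close>
    and peaks at \<open>c - b\<close>. This \<open>b\<close> maximises its expectation for mean
    \<open>c - D\<close> and variance \<open>V\<close>.\<close>
  define b where "b = D + V / D"
  have b: "0 < b" using D V by (simp add: b_def add_pos_nonneg)
  have int1 [simp]: "integrable M S"
    using square_integrable_imp_integrable[OF _ int] by simp
  define f where "f x = 1 - (x - c + b)\<^sup>2 / b\<^sup>2" for x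
  have f: "f x = (1 - (b - c)\<^sup>2 / b\<^sup>2) - (2 * (b - c) / b\<^sup>2) * x - (1 / b\<^sup>2) * x\<^sup>2" for x
    using b by (simp add: f_def power2_eq_square field_simps)
  have "expectation (\<lambda>\<omega>. f (S \<omega>)) \<le> prob {\<omega> \<in> space M. S \<omega> \<le> c}"
  proof (rule expectation_le_prob_atMost)
    show "integrable M (\<lambda>\<omega>. f (S \<omega>))" unfolding f using int by simp
    show "f x \<le> 0" if "c < x" for x
    proof -
      have "b\<^sup>2 \<le> (x - c + b)\<^sup>2" using that b by (intro power_mono) auto
      thus ?thesis using b by (simp add: f_def)
    qed
  qed (simp_all add: f_def)
  also have "expectation (\<lambda>\<omega>. f (S \<omega>)) = 1 - ((b - D)\<^sup>2 + V) / b\<^sup>2"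
  proof -
    have ES: "expectation S = c - D" using D by simp
    have "expectation (\<lambda>\<omega>. f (S \<omega>)) = 1 - ((b - c)\<^sup>2 + 2 * (b - c) * (c - D) + (V + (c - D)\<^sup>2)) / b\<^sup>2"
      unfolding f using int by (simp add: prob_space ES V add_divide_distrib)
    also have "(b - c)\<^sup>2 + 2 * (b - c) * (c - D) + (V + (c - D)\<^sup>2) = (b - D)\<^sup>2 + V"
      by (simp add: power2_eq_square algebra_simps)
    finally show ?thesis .
  qed
  also have "\<dots> = D\<^sup>2 / (D\<^sup>2 + V)"
  proof -
    define W where "W = D\<^sup>2 + V"
    have W: "0 < W" using D V by (simp add: W_def add_pos_nonneg)
    have "b = W / D" "b - D = V / D" using D by (auto simp: W_def b_def power2_eq_square field_simps)
    hence "b\<^sup>2 = W\<^sup>2 / D\<^sup>2" "(b - D)\<^sup>2 + V = V * W / D\<^sup>2"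
      using D(2) by (simp_all add: W_def power_divide) (simp add: power2_eq_square field_simps)
    hence "((b - D)\<^sup>2 + V) / b\<^sup>2 = V / W"
      using D(2) W by (simp add: power2_eq_square)
    also have "1 - V / W = D\<^sup>2 / W" using W by (simp add: W_def field_simps)
    finally show ?thesis by (simp add: W_def)
  qed
  finally show ?thesis .
qed

text \<open>The lower bound obtained from \<^term>\<open>test_fun\<close> for a sum with mean \<open>1 - a R\<close> and
  variance \<open>v R\<^sup>2\<close> whose summands have range \<open>R\<close>; \<open>3/2 = 1 - cos (2 \<pi> / 3)\<close> comes from
  the characteristic function.\<close>

definition char_bound :: "real \<Rightarrow> real \<Rightarrow> real" where
  "char_bound a v = (let t = 2 * pi / 3; m = 11/4 + t * a in
     (m - 1 - 59/1000 * (m\<^sup>2 + t\<^sup>2 * v) - sqrt 2 * exp (- (3/2) * v)) / (423/100))"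

text \<open>The expectation is the real part of the characteristic function rotated by
  \<open>cis (- c)\<close>, and a rotation keeps the modulus.\<close>

lemma (in real_distribution) expectation_cos_ge:
  "- cmod (char M t) \<le> expectation (\<lambda>x. cos (t * x - c))"
proof -
  have "integrable M (\<lambda>x. iexp (t * x))"
    by (intro integrable_const_bound[where B = 1]) auto
  hence "integrable M (\<lambda>x. iexp (t * x) * cis (- c))" 
    and eq: "char M t * cis (- c) = (CLINT x|M. iexp (t * x) * cis (- c))"
    by (auto simp: char_def)
  have "- cmod (char M t * cis (- c)) \<le> Re (char M t * cis (- c))"
    using abs_Re_le_cmod[of "char M t * cis (- c)"] by linarith
  also have "\<dots> = expectation (\<lambda>x. Re (iexp (t * x) * cis (- c)))"
    unfolding eq by (rule integral_Re[symmetric]) fact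
  also have "(\<lambda>x. Re (iexp (t * x) * cis (- c))) = (\<lambda>x. cos (t * x - c))"
    by (auto simp: cos_diff Re_exp Im_exp)
  finally show ?thesis by (simp add: norm_mult)
qed

lemma (in prob_space) indep_sum_bounds:
  fixes Y :: "'i \<Rightarrow> 'a \<Rightarrow> real"
  assumes I: "finite I" and indep: "indep_vars (\<lambda>_. borel) Y I" and R: "0 < R"
    and bd: "\<And>i. i \<in> I \<Longrightarrow> AE \<omega> in M. - 1 \<le> Y i \<omega> \<and> Y i \<omega> \<le> R - 1"
    and D: "D = 1 - (\<Sum>i\<in>I. expectation (Y i))" "0 < D"
    and V: "V = (\<Sum>i\<in>I. expectation (\<lambda>\<omega>. (Y i \<omega>)\<^sup>2) - (expectation (Y i))\<^sup>2)"
  shows "D\<^sup>2 / (D\<^sup>2 + V) \<le> prob {\<omega> \<in> space M. (\<Sum>i\<in>I. Y i \<omega>) \<le> 1}"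
    and "char_bound (D / R) (V / R\<^sup>2) \<le> prob {\<omega> \<in> space M. (\<Sum>i\<in>I. Y i \<omega>) \<le> 1}"
    and "0 \<le> V"
proof -
  define S where "S = (\<lambda>\<omega>. \<Sum>i\<in>I. Y i \<omega>)"
  have rv: "random_variable borel (Y i)" if "i \<in> I" for i
    using indep that by (auto simp: indep_vars_def2)
  hence [measurable]: "S \<in> borel_measurable M" unfolding S_def by auto
  have sq: "integrable M (\<lambda>\<omega>. (Y i \<omega>)\<^sup>2)" if i: "i \<in> I" for i
  proof (rule integrable_const_bound[where B = "(1 + R)\<^sup>2"])
    show "AE x in M. norm ((Y i x)\<^sup>2) \<le> (1 + R)\<^sup>2"
      using bd[OF i]
    proof eventually_elim
      case (elim x)
      hence "\<bar>Y i x\<bar> \<le> \<bar>1 + R\<bar>" using R by auto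
      thus ?case by (simp add: abs_le_square_iff)
    qed
  qed (use rv[OF i] in measurable)
  have int: "integrable M (Y i)" if "i \<in> I" for i
    using square_integrable_imp_integrable[OF rv[OF that] sq[OF that]] .
  have intS2: "integrable M (\<lambda>\<omega>. (S \<omega>)\<^sup>2)"
    and ES2: "expectation (\<lambda>\<omega>. (S \<omega>)\<^sup>2) = V + (expectation S)\<^sup>2"
    using second_moment_indep_sum[OF I indep sq] int by (simp_all add: S_def V)
  have intS: "integrable M S" using int by (simp add: S_def)
  have ES: "D = 1 - expectation S" using int by (simp add: S_def D)
  show "0 \<le> V"
  proof -
    have "0 \<le> expectation (\<lambda>\<omega>. (Y i \<omega>)\<^sup>2) - (expectation (Y i))\<^sup>2" if "i \<in> I" for i
      using variance_eq[OF int[OF that] sq[OF that]] variance_positive[of "Y i"] by simp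
    thus ?thesis unfolding V by (intro sum_nonneg)
  qed
  show "D\<^sup>2 / (D\<^sup>2 + V) \<le> prob {\<omega> \<in> space M. (\<Sum>i\<in>I. Y i \<omega>) \<le> 1}"
    using cantelli_atMost[OF \<open>S \<in> borel_measurable M\<close> intS2 ES D(2) ES2 \<open>0 \<le> V\<close>]
    by (simp add: S_def)

  define t where "t = 2 * pi / 3"
  have t: "0 < t" "t \<le> pi" "1 - cos t = 3/2"
    using pi_gt_zero cos_120 by (auto simp: t_def)
  define m where "m = 11/4 + t * (D / R)"
  \<comment> \<open>This affine map sends the threshold 1 to \<open>- 11/4\<close>, from where on
    the test function is nonpositive, and the mean of \<open>S\<close> to
    \<open>- m\<close>.\<close>
  define s where "s x = t / R * x - (t / R + 11/4)" for x
  interpret distrS: real_distribution "distr M borel S"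
    by (rule real_distribution_distr) simp
  \<comment> \<open>By independence the characteristic function factorises, and the exponents of the
    factors add up to a multiple of \<open>V\<close>.\<close>
  have cmodS: "cmod (char (distr M borel S) (t / R)) \<le> exp (- (3/2) * (V / R\<^sup>2))"
  proof -
    have "cmod (char (distr M borel S) (t / R)) = (\<Prod>i\<in>I. cmod (char (distr M borel (Y i)) (t / R)))"
      unfolding S_def char_distr_sum[OF indep] by (simp add: prod_norm)
    also have "\<dots> \<le> (\<Prod>i\<in>I. exp (- (3/2) * ((expectation (\<lambda>\<omega>. (Y i \<omega>)\<^sup>2) - (expectation (Y i))\<^sup>2) / R\<^sup>2)))"
    proof (rule prod_mono, safe)
      fix i assume i: "i \<in> I"
      note [measurable] = rv[OF i]
      interpret Yi: real_distribution "distr M borel (Y i)"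
        by (rule real_distribution_distr) simp
      have "AE x in distr M borel (Y i). - 1 \<le> x \<and> x \<le> - 1 + R"
        using bd[OF i] by (subst AE_distr_iff) auto
      from Yi.cmod_char_le_exp_variance[OF R t(1,2) this]
      show "cmod (char (distr M borel (Y i)) (t / R))
        \<le> exp (- (3/2) * ((expectation (\<lambda>\<omega>. (Y i \<omega>)\<^sup>2) - (expectation (Y i))\<^sup>2) / R\<^sup>2))"
        unfolding t(3) by (simp add: integral_distr)
    qed simp
    also have "\<dots> = exp (- (3/2) * (V / R\<^sup>2))"
      using I by (simp add: exp_sum[symmetric] V sum_divide_distrib sum_distrib_left)
    finally show ?thesis .
  qed
  have intc: "integrable M (\<lambda>\<omega>. cos (t / R * S \<omega> - c))" for c
    by (intro integrable_const_bound[where B = 1]) auto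
  have "test_fun (q * x - (q + 11/4)) = sqrt 2 * cos (q * x - (q + 11/4 + pi/4)) - 1
    - (q * x - (q + 11/4)) - 59/1000 * (q\<^sup>2 * x\<^sup>2 - 2 * q * (q + 11/4) * x + (q + 11/4)\<^sup>2)" for q x
    using cos_add_sin[of "q * x - (q + 11/4)"]
    by (simp add: test_fun_def power2_diff power_mult_distrib diff_diff_eq)
  hence Hs: "test_fun (s x) = sqrt 2 * cos (t / R * x - (t / R + 11/4 + pi/4)) - 1
    - (t / R * x - (t / R + 11/4)) - 59/1000 * ((t / R)\<^sup>2 * x\<^sup>2 - 2 * (t / R) * (t / R + 11/4) * x + (t / R + 11/4)\<^sup>2)" for x
    unfolding s_def .
  have "expectation (\<lambda>\<omega>. test_fun (s (S \<omega>)) / (423/100)) \<le> prob {\<omega> \<in> space M. S \<omega> \<le> 1}"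
  proof (rule expectation_le_prob_atMost)
    show "integrable M (\<lambda>\<omega>. test_fun (s (S \<omega>)) / (423/100))"
      unfolding Hs using intc intS intS2 by simp
    show "test_fun (s x) / (423/100) \<le> 1" for x using test_fun_le[of "s x"] by simp
    show "test_fun (s x) / (423/100) \<le> 0" if "1 < x" for x
    proof -
      have "t / R * 1 \<le> t / R * x" using that R t by (intro mult_left_mono) auto
      hence "test_fun (s x) \<le> 0" by (intro test_fun_nonpos) (simp add: s_def)
      thus ?thesis by simp
    qed
  qed simp
  moreover have "expectation (\<lambda>\<omega>. test_fun (s (S \<omega>))) = sqrt 2 * expectation (\<lambda>\<omega>. cos (t / R * S \<omega> - (t / R + 11/4 + pi/4)))
    - 1 + m - 59/1000 * (m\<^sup>2 + t\<^sup>2 * (V / R\<^sup>2))"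
  proof -
    define q where "q = t / R"
    have ES': "expectation S = 1 - D" using ES by simp
    have qm: "m = 11/4 + q * D" "t\<^sup>2 * (V / R\<^sup>2) = q\<^sup>2 * V"
      by (simp_all add: m_def q_def power_divide)
    have "expectation (\<lambda>\<omega>. test_fun (s (S \<omega>))) = sqrt 2 * expectation (\<lambda>\<omega>. cos (q * S \<omega> - (q + 11/4 + pi/4)))
      - 1 - (q * expectation S - (q + 11/4))
      - 59/1000 * (q\<^sup>2 * expectation (\<lambda>\<omega>. (S \<omega>)\<^sup>2) - 2 * q * (q + 11/4) * expectation S + (q + 11/4)\<^sup>2)"
      unfolding Hs q_def[symmetric] using intc[folded q_def] intS intS2 by (simp add: prob_space)
    also have "\<dots> = sqrt 2 * expectation (\<lambda>\<omega>. cos (q * S \<omega> - (q + 11/4 + pi/4)))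
      - 1 + m - 59/1000 * (m\<^sup>2 + t\<^sup>2 * (V / R\<^sup>2))"
      unfolding ES2 ES' qm by (simp add: power2_eq_square field_simps)
    finally show ?thesis by (simp only: q_def)
  qed
  moreover have "sqrt 2 * expectation (\<lambda>\<omega>. cos (t / R * S \<omega> - c)) \<ge> sqrt 2 * - exp (- (3/2) * (V / R\<^sup>2))" for c
  proof (rule mult_left_mono)
    have "expectation (\<lambda>\<omega>. cos (t / R * S \<omega> - c)) = distrS.expectation (\<lambda>x. cos (t / R * x - c))"
      by (simp add: integral_distr)
    thus "- exp (- (3/2) * (V / R\<^sup>2)) \<le> expectation (\<lambda>\<omega>. cos (t / R * S \<omega> - c))"
      using distrS.expectation_cos_ge[of "t / R" c] cmodS by simp
  qed simp
  ultimately have "m - 1 - 59/1000 * (m\<^sup>2 + t\<^sup>2 * (V / R\<^sup>2)) - sqrt 2 * exp (- (3/2) * (V / R\<^sup>2))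
      \<le> expectation (\<lambda>\<omega>. test_fun (s (S \<omega>)))"
    and le: "expectation (\<lambda>\<omega>. test_fun (s (S \<omega>))) / (423/100) \<le> prob {\<omega> \<in> space M. S \<omega> \<le> 1}"
    by simp_all
  hence "(m - 1 - 59/1000 * (m\<^sup>2 + t\<^sup>2 * (V / R\<^sup>2)) - sqrt 2 * exp (- (3/2) * (V / R\<^sup>2))) / (423/100)
      \<le> prob {\<omega> \<in> space M. S \<omega> \<le> 1}"
    using le by (intro order.trans[OF divide_right_mono le]) auto
  thus "char_bound (D / R) (V / R\<^sup>2) \<le> prob {\<omega> \<in> space M. (\<Sum>i\<in>I. Y i \<omega>) \<le> 1}"
    unfolding char_bound_def Let_def t_def[symmetric] m_def[symmetric] S_def .
qed

subsection \<open>Numerical estimates\<close>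

lemma exp_lower_pow:
  fixes x y :: real
  assumes "x = of_nat n * y" "0 \<le> y"
  shows "(1 + y + y\<^sup>2 / 2) ^ n \<le> exp x"
proof -
  have "(1 + y + y\<^sup>2 / 2) ^ n \<le> exp y ^ n"
    using exp_lower_Taylor_quadratic[OF assms(2)] assms(2) by (intro power_mono) auto
  thus ?thesis by (simp add: assms(1) exp_of_nat_mult)
qed

text \<open>The exponents here and in the next lemma are \<open>- (3/2) * v\<close> at the ends
  \<open>v = 1.4\<close> and \<open>v = 0.8\<close> of the medium variance range.\<close>

lemma exp_minus_2_1: "exp (- 21/10 :: real) \<le> 126/1000"
proof -
  have "1000/126 \<le> (1 + 21/100 + (21/100)\<^sup>2 / 2 :: real) ^ 10" by (simp add: power2_eq_square power_divide)
  also have "\<dots> \<le> exp (21/10)" by (rule exp_lower_pow) auto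
  finally show ?thesis by (simp add: exp_minus field_simps)
qed

lemma exp_minus_1_2: "exp (- 12/10 :: real) \<le> 305/1000"
proof -
  have "1000/305 \<le> (1 + 2/10 + (2/10)\<^sup>2 / 2 :: real) ^ 6" by (simp add: power2_eq_square power_divide)
  also have "\<dots> \<le> exp (12/10)" by (rule exp_lower_pow) auto
  finally show ?thesis by (simp add: exp_minus field_simps)
qed

lemma exp_0_65: "exp (65/100 :: real) \<le> 192/100"
proof -
  obtain t where t: "\<bar>t\<bar> \<le> \<bar>65/100 :: real\<bar>"
    and eq: "exp (65/100) = (\<Sum>m<5. (65/100) ^ m / fact m) + exp t / fact 5 * (65/100) ^ 5"
    using Maclaurin_exp_le[of "65/100" 5] by blast
  have "{..<5::nat} = {0,1,2,3,4}" by auto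
  hence "(\<Sum>m<5. (65/100) ^ m / fact m) = (2450507/1280000 :: real)"
    by (simp add: fact_numeral power_divide)
  moreover have "exp t / fact 5 * (65/100) ^ 5 = exp t * (371293/384000000)"
    by (simp add: fact_numeral power_divide)
  \<comment> \<open>The remainder is bounded by the unknown value itself; its small coefficient
    makes the resulting linear inequality solvable for \<open>exp (65/100)\<close>.\<close>
  moreover have "exp t \<le> exp (65/100)" using t by simp
  ultimately show ?thesis using eq by linarith
qed

text \<open>Convexity of the exponential. Since \<open>A\<close> and \<open>B\<close> may be any
  overestimates at the ends, the chord can be taken with rational coefficients.\<close>

lemma exp_chord:
  assumes "a \<le> x" "x \<le> b" "a < (b::real)" "exp a \<le> A" "exp b \<le> B"
  shows "exp x \<le> A + (B - A) * ((x - a) / (b - a))"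
proof -
  define l where "l = (x - a) / (b - a)"
  have l: "0 \<le> l" "l \<le> 1" using assms by (auto simp: l_def)
  have "x = (1 - l) * a + l * b"
  proof -
    have "l * (b - a) = x - a" using assms by (simp add: l_def)
    thus ?thesis by (simp add: algebra_simps)
  qed
  hence "exp x \<le> (1 - l) * exp a + l * exp b"
    using convex_onD[OF exp_convex, of l a b] l by simp
  also have "\<dots> \<le> (1 - l) * A + l * B"
    using assms l by (intro add_mono mult_left_mono) auto
  also have "\<dots> = A + (B - A) * l" by (simp add: algebra_simps)
  finally show ?thesis unfolding l_def .
qed

text \<open>Replaces irrational constants by decimals. Rounding \<open>m\<close> down is safe
  because \<open>m - 59/1000 * m^2\<close> increases for \<open>m \<le> 5\<close>;
  \<open>0.2589\<close> exceeds \<open>0.059 * (2 * pi / 3)^2\<close>.\<close>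

lemma char_bound_ge:
  assumes mt: "m \<le> 11/4 + 2 * pi / 3 * a" "m \<le> 5" "0 \<le> a" "a \<le> 1" "0 \<le> v" and E: "exp (- (3/2) * v) \<le> E"
  shows "(m - 1 - 59/1000 * m\<^sup>2 - 2589/10000 * v - 14143/10000 * E) / (423/100) \<le> char_bound a v"
proof -
  define t where "t = 2 * pi / 3"
  define n where "n = 11/4 + t * a"
  have t: "2094/1000 \<le> t" "t \<le> 20947/10000" using pi_gt pi_lt by (simp_all add: t_def)
  have "m \<le> n" using mt by (simp only: n_def t_def)
  have "t * a \<le> 20947/10000 * 1" using t assms by (intro mult_mono) auto
  hence "n \<le> 5" by (simp add: n_def)
  have "0 \<le> (n - m) * (1 - 59/1000 * (n + m))"
    using \<open>m \<le> n\<close> \<open>n \<le> 5\<close> \<open>m \<le> 5\<close> by (intro mult_nonneg_nonneg) auto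
  hence 1: "m - 59/1000 * m\<^sup>2 \<le> n - 59/1000 * n\<^sup>2" by (simp add: power2_eq_square field_simps)
  have "t\<^sup>2 \<le> (20947/10000)\<^sup>2" using t by (intro power_mono) auto
  hence "59/1000 * t\<^sup>2 * v \<le> 2589/10000 * v"
    using assms by (intro mult_right_mono) (auto simp: power2_eq_square)
  moreover have "sqrt 2 * exp (- (3/2) * v) \<le> 14143/10000 * E"
    using sqrt2_bounds E by (intro mult_mono) auto
  ultimately have "m - 1 - 59/1000 * m\<^sup>2 - 2589/10000 * v - 14143/10000 * E
    \<le> n - 1 - 59/1000 * (n\<^sup>2 + t\<^sup>2 * v) - sqrt 2 * exp (- (3/2) * v)"
    using 1 by (simp add: field_simps)
  hence "(m - 1 - 59/1000 * m\<^sup>2 - 2589/10000 * v - 14143/10000 * E) / (423/100)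
    \<le> (n - 1 - 59/1000 * (n\<^sup>2 + t\<^sup>2 * v) - sqrt 2 * exp (- (3/2) * v)) / (423/100)"
    by (rule divide_right_mono) simp
  thus ?thesis
    by (simp only: char_bound_def Let_def t_def[symmetric] n_def[symmetric])
qed

text \<open>The chord for \<open>exp a\<close> and \<open>a^2 \<le> 0.65 * a\<close> reduce the
  claim to an affine inequality in \<open>a\<close>. The tight end is \<open>a = 0\<close>, where
  the decimal lower bound is about 0.1804.\<close>

lemma char_bound_ge_large_variance:
  assumes "0 \<le> a" "a \<le> 65/100"
  shows "1798/10000 * exp a \<le> char_bound a (14/10)"
proof -
  define m where "m = 11/4 + 2094/1000 * a"
  have "exp a \<le> 1 + 92/65 * a"
    using exp_chord[of 0 a "65/100" 1 "192/100"] exp_0_65 assms by simp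
  moreover have "1798/10000 * (1 + 92/65 * a)
    \<le> (m - 1 - 59/1000 * m\<^sup>2 - 2589/10000 * (14/10) - 14143/10000 * (126/1000)) / (423/100)" (is "_ \<le> ?X / _")
  proof -
    have "a\<^sup>2 \<le> 65/100 * a" using assms mult_right_mono[of a "65/100" a] by (simp add: power2_eq_square)
    moreover have "?X = 7631507/10000000 + 1414497/1000000 * a - 258705324/1000000000 * a\<^sup>2"
      by (simp add: m_def power2_sum power_mult_distrib field_simps)
    ultimately have "1798/10000 * (1 + 92/65 * a) * (423/100) \<le> ?X" using assms by simp
    thus ?thesis by (simp only: pos_le_divide_eq)
  qed
  moreover have "\<dots> \<le> char_bound a (14/10)"
  proof (rule char_bound_ge)
    show "m \<le> 11/4 + 2 * pi / 3 * a"
      using pi_gt assms mult_right_mono[of "2094/1000" "2 * pi / 3" a] by (simp add: m_def)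
  qed (use assms exp_minus_2_1 in \<open>auto simp: m_def\<close>)
  ultimately show ?thesis by simp
qed

text \<open>With the exponential replaced by its chord over this range, the claim becomes an affine
  inequality in \<open>v\<close>.\<close>

lemma char_bound_ge_medium_variance:
  assumes "8/10 \<le> v" "v \<le> 14/10"
  shows "1798/10000 * exp (65/100) \<le> char_bound (65/100) v"
proof -
  define e where "e = 305/1000 - 179/1000 * ((v - 8/10) / (6/10))"
  have "exp (- (3/2) * v) \<le> e"
    using exp_chord[of "- 21/10" "- (3/2) * v" "- 12/10" "126/1000" "305/1000"] exp_minus_2_1 exp_minus_1_2 assms
    by (simp add: e_def field_simps)
  moreover have "4111/1000 \<le> 11/4 + 2 * pi / 3 * (65/100)"
    using pi_gt by simp
  ultimately have "(4111/1000 - 1 - 59/1000 * (4111/1000)\<^sup>2 - 2589/10000 * v - 14143/10000 * e) / (423/100)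
    \<le> char_bound (65/100) v"
    using assms by (intro char_bound_ge) auto
  moreover have "1798/10000 * (192/100) \<le> (4111/1000 - 1 - 59/1000 * (4111/1000)\<^sup>2 - 2589/10000 * v - 14143/10000 * e) / (423/100)"
    using assms by (simp add: e_def power2_eq_square field_simps)
  ultimately show ?thesis using exp_0_65 by linarith
qed

text \<open>This limits the threshold \<open>0.8\<close>: there the right-hand side is about 0.3456,
  against 0.3452 for \<open>0.1798 * 1.92\<close>.\<close>

lemma cantelli_bound_ge:
  fixes v :: real
  assumes "0 \<le> v" "v \<le> 8/10"
  shows "1798/10000 * exp (65/100) \<le> (65/100)\<^sup>2 / ((65/100)\<^sup>2 + v)"
proof -
  have pos: "0 < (65/100)\<^sup>2 + v" using assms by (intro add_pos_nonneg) auto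
  have "1798/10000 * exp (65/100) * ((65/100)\<^sup>2 + v) \<le> 1798/10000 * (192/100) * ((65/100)\<^sup>2 + v)"
    using exp_0_65 pos by (intro mult_right_mono mult_left_mono) auto
  also have "\<dots> \<le> (65/100)\<^sup>2" using assms by (simp add: power2_eq_square)
  finally show ?thesis using pos by (simp only: pos_le_divide_eq)
qed

subsection \<open>Reweighting and truncation\<close>

text \<open>A density that is a product over the indices keeps the variables independent and
  reweights each marginal by \<open>W / p i\<close>. As \<open>W \<le> 1\<close>, the density is at
  most the inverse of the product of the \<open>p i\<close>, which gives the comparison of
  probabilities at the end.\<close>

lemma (in prob_space) product_density:
  fixes X :: "'i \<Rightarrow> 'a \<Rightarrow> real" and W :: "real \<Rightarrow> real" and p :: "'i \<Rightarrow> real"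
  assumes I: "finite I" and indep: "indep_vars (\<lambda>_. borel) X I"
    and W [measurable]: "W \<in> borel_measurable borel" and W01: "\<And>x. 0 \<le> W x" "\<And>x. W x \<le> 1"
    and p_eq: "\<And>i. p i = expectation (\<lambda>\<omega>. W (X i \<omega>))" and p_pos: "\<forall>i\<in>I. 0 < p i"
    and N: "N = density M (\<lambda>\<omega>. ennreal (\<Prod>i\<in>I. W (X i \<omega>) / p i))"
  shows "prob_space N" and "prob_space.indep_vars N (\<lambda>_. borel) X I"
    and "\<And>i f. i \<in> I \<Longrightarrow> f \<in> borel_measurable borel \<Longrightarrow> integrable M (\<lambda>\<omega>. W (X i \<omega>) * f (X i \<omega>)) \<Longrightarrow>
      integral\<^sup>L N (\<lambda>\<omega>. f (X i \<omega>)) = expectation (\<lambda>\<omega>. W (X i \<omega>) * f (X i \<omega>)) / p i"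
    and "\<And>i P. i \<in> I \<Longrightarrow> Measurable.pred borel P \<Longrightarrow>
      AE \<omega> in M. 0 < W (X i \<omega>) \<longrightarrow> P (X i \<omega>) \<Longrightarrow> AE \<omega> in N. P (X i \<omega>)"
    and "\<And>A. A \<in> sets M \<Longrightarrow> (\<Prod>i\<in>I. p i) * measure N A \<le> prob A"
proof -
  have p: "p i = expectation (\<lambda>\<omega>. W (X i \<omega>))" "0 < p i" if "i \<in> I" for i
    using p_eq p_pos that by auto
  define G where "G = (\<lambda>\<omega>. \<Prod>i\<in>I. W (X i \<omega>) / p i)"
  have rv [measurable]: "X i \<in> borel_measurable M" if "i \<in> I" for i
    using indep that by (auto simp: indep_vars_def2)
  have G [measurable]: "G \<in> borel_measurable M" unfolding G_def by measurable
  have G0: "0 \<le> G \<omega>" for \<omega>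
    unfolding G_def using p(2) W01 by (intro prod_nonneg) (auto intro!: divide_nonneg_pos)
  have N': "N = density M (\<lambda>\<omega>. ennreal (G \<omega>))" unfolding N G_def ..
  have space_N [simp]: "space N = space M" and sets_N [simp, measurable_cong]: "sets N = sets M"
    by (simp_all add: N')
  have intW: "integrable M (\<lambda>\<omega>. W (X i \<omega>))" if "i \<in> I" for i
    using that W01 by (intro integrable_const_bound[where B = 1]) auto
  \<comment> \<open>Both the reweighted marginals and the independence follow from this formula, by
    setting \<open>g\<close> to 1 at the indices that should drop out.\<close>
  have prod_formula: "integral\<^sup>L N (\<lambda>\<omega>. \<Prod>i\<in>I. g i (X i \<omega>)) = (\<Prod>i\<in>I. expectation (\<lambda>\<omega>. W (X i \<omega>) * g i (X i \<omega>)) / p i)"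
    if g: "\<And>i. i \<in> I \<Longrightarrow> g i \<in> borel_measurable borel"
      and int: "\<And>i. i \<in> I \<Longrightarrow> integrable M (\<lambda>\<omega>. W (X i \<omega>) * g i (X i \<omega>))" for g :: "'i \<Rightarrow> real \<Rightarrow> real"
  proof -
    note [measurable] = g
    have ind: "indep_vars (\<lambda>_. borel) (\<lambda>i \<omega>. W (X i \<omega>) * g i (X i \<omega>) / p i) I"
      by (rule indep_vars_compose2[OF indep, of "\<lambda>i x. W x * g i x / p i"]) (use g in measurable)
    have "integral\<^sup>L N (\<lambda>\<omega>. \<Prod>i\<in>I. g i (X i \<omega>)) = expectation (\<lambda>\<omega>. G \<omega> * (\<Prod>i\<in>I. g i (X i \<omega>)))"
      unfolding N' by (subst integral_density) (auto simp: G0)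
    also have "\<dots> = expectation (\<lambda>\<omega>. \<Prod>i\<in>I. W (X i \<omega>) * g i (X i \<omega>) / p i)"
      by (simp add: G_def prod.distrib[symmetric] mult_ac)
    also have "\<dots> = (\<Prod>i\<in>I. expectation (\<lambda>\<omega>. W (X i \<omega>) * g i (X i \<omega>) / p i))"
      using int by (intro indep_vars_lebesgue_integral[OF I ind]) simp
    finally show ?thesis by simp
  qed
  have one: "expectation (\<lambda>\<omega>. W (X i \<omega>)) / p i = 1" if "i \<in> I" for i
    using p that by fastforce
  show "prob_space N"
  proof
    have int: "integrable M G" and "expectation G = (\<Prod>i\<in>I. expectation (\<lambda>\<omega>. W (X i \<omega>) / p i))"
    proof -
      have ind: "indep_vars (\<lambda>_. borel) (\<lambda>i \<omega>. W (X i \<omega>) / p i) I"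
        by (rule indep_vars_compose2[OF indep, of "\<lambda>i x. W x / p i"]) measurable
      show "integrable M G"
        unfolding G_def by (rule indep_vars_integrable[OF I ind]) (simp add: intW)
      show "expectation G = (\<Prod>i\<in>I. expectation (\<lambda>\<omega>. W (X i \<omega>) / p i))"
        unfolding G_def by (rule indep_vars_lebesgue_integral[OF I ind]) (simp add: intW)
    qed
    hence "expectation G = 1" using one by simp
    hence "(\<integral>\<^sup>+\<omega>. ennreal (G \<omega>) \<partial>M) = 1"
      using int G0 by (subst nn_integral_eq_integral) auto
    thus "emeasure N (space N) = 1"
      by (simp add: N' emeasure_density nn_integral_set_ennreal cong: nn_integral_cong)
  qed
  then interpret N: prob_space N .
  show single: "integral\<^sup>L N (\<lambda>\<omega>. f (X i \<omega>)) = expectation (\<lambda>\<omega>. W (X i \<omega>) * f (X i \<omega>)) / p i"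
    if i: "i \<in> I" and f: "f \<in> borel_measurable borel" and int: "integrable M (\<lambda>\<omega>. W (X i \<omega>) * f (X i \<omega>))" for i f
  proof -
    define g where "g j = (if j = i then f else (\<lambda>_. 1))" for j
    have "(\<lambda>\<omega>. f (X i \<omega>)) = (\<lambda>\<omega>. \<Prod>j\<in>I. g j (X j \<omega>))"
      using I i by (auto simp: g_def if_distrib[of "\<lambda>h. h _"] prod.delta cong: if_cong)
    hence "integral\<^sup>L N (\<lambda>\<omega>. f (X i \<omega>)) = integral\<^sup>L N (\<lambda>\<omega>. \<Prod>j\<in>I. g j (X j \<omega>))"
      by (simp only:)
    also have "\<dots> = (\<Prod>j\<in>I. expectation (\<lambda>\<omega>. W (X j \<omega>) * g j (X j \<omega>)) / p j)"
      using f int intW by (intro prod_formula) (auto simp: g_def)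
    also have "\<dots> = (\<Prod>j\<in>I. if j = i then expectation (\<lambda>\<omega>. W (X i \<omega>) * f (X i \<omega>)) / p i else 1)"
      by (intro prod.cong) (auto simp: g_def one)
    finally show ?thesis using I i by simp
  qed
  show "N.indep_vars (\<lambda>_. borel) X I"
    unfolding N.indep_vars_def2
  proof (intro conjI ballI N.indep_setsI)
    show "X i \<in> borel_measurable N" if "i \<in> I" for i using rv[OF that] by simp
    show "{X i -` A \<inter> space N |A. A \<in> sets borel} \<subseteq> N.events" if "i \<in> I" for i
      using rv[OF that] by (auto intro: measurable_sets)
    fix A J assume J: "J \<noteq> {}" "J \<subseteq> I" "finite J"
      and "\<forall>j\<in>J. A j \<in> {X j -` A \<inter> space N |A. A \<in> sets borel}"
    then obtain B where B: "\<And>j. j \<in> J \<Longrightarrow> A j = X j -` B j \<inter> space M" "\<And>j. j \<in> J \<Longrightarrow> B j \<in> sets borel"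
      by simp metis
    have A [measurable]: "A j \<in> sets M" if "j \<in> J" for j
      using B[OF that] rv[of j] J that by (auto intro: measurable_sets)
    define g :: "'i \<Rightarrow> real \<Rightarrow> real" where "g j = (if j \<in> J then indicator (B j) else (\<lambda>_. 1))" for j
    have intg: "integrable M (\<lambda>\<omega>. W (X j \<omega>) * g j (X j \<omega>))" and gm: "g j \<in> borel_measurable borel" if "j \<in> I" for j
    proof -
      show [measurable]: "g j \<in> borel_measurable borel" using B by (auto simp: g_def)
      show "integrable M (\<lambda>\<omega>. W (X j \<omega>) * g j (X j \<omega>))"
      proof (rule integrable_const_bound[where B = 1])
        show "(\<lambda>\<omega>. W (X j \<omega>) * g j (X j \<omega>)) \<in> borel_measurable M"
          using rv[OF that] by measurable
      qed (use W01 in \<open>auto simp: g_def indicator_def\<close>)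
    qed
    have pj: "N.prob (A j) = expectation (\<lambda>\<omega>. W (X j \<omega>) * g j (X j \<omega>)) / p j" if "j \<in> J" for j
    proof -
      have "N.prob (A j) = integral\<^sup>L N (indicator (A j))" using A[OF that] by simp
      also have "\<dots> = integral\<^sup>L N (\<lambda>\<omega>. g j (X j \<omega>))"
        using B that by (intro Bochner_Integration.integral_cong) (auto simp: g_def indicator_def)
      finally show ?thesis using single[of j "g j"] gm[of j] intg[of j] that J by auto
    qed
    have "N.prob (\<Inter>j\<in>J. A j) = integral\<^sup>L N (indicator (\<Inter>j\<in>J. A j))"
    proof -
      have "(\<Inter>j\<in>J. A j) \<in> sets M" using J A by (intro sets.finite_INT) auto
      thus ?thesis by simp
    qed
    also have "\<dots> = integral\<^sup>L N (\<lambda>\<omega>. \<Prod>j\<in>I. g j (X j \<omega>))"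
    proof (intro Bochner_Integration.integral_cong refl)
      fix \<omega> assume \<omega>: "\<omega> \<in> space N"
      have "(\<Prod>j\<in>I. g j (X j \<omega>)) = (\<Prod>j\<in>J. g j (X j \<omega>))"
        using J I by (intro prod.mono_neutral_right) (auto simp: g_def)
      also have "\<dots> = (\<Prod>j\<in>J. indicator (A j) \<omega>)"
        using B \<omega> by (intro prod.cong) (auto simp: g_def indicator_def)
      also have "\<dots> = indicator (\<Inter>j\<in>J. A j) \<omega>"
        using J by (auto simp: indicator_def intro!: prod_zero)
      finally show "indicator (\<Inter>j\<in>J. A j) \<omega> = (\<Prod>j\<in>I. g j (X j \<omega>))" ..
    qed
    also have "\<dots> = (\<Prod>j\<in>I. expectation (\<lambda>\<omega>. W (X j \<omega>) * g j (X j \<omega>)) / p j)"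
      by (rule prod_formula[OF gm intg])
    also have "\<dots> = (\<Prod>j\<in>J. expectation (\<lambda>\<omega>. W (X j \<omega>) * g j (X j \<omega>)) / p j)"
      using J I by (intro prod.mono_neutral_right) (auto simp: g_def one)
    also have "\<dots> = (\<Prod>j\<in>J. N.prob (A j))" using pj by simp
    finally show "N.prob (\<Inter>j\<in>J. A j) = (\<Prod>j\<in>J. N.prob (A j))" .
  qed
  show "AE \<omega> in N. P (X i \<omega>)"
    if i: "i \<in> I" and P: "Measurable.pred borel P" and ae: "AE \<omega> in M. 0 < W (X i \<omega>) \<longrightarrow> P (X i \<omega>)" for i P
  proof -
    have "AE \<omega> in M. 0 < ennreal (G \<omega>) \<longrightarrow> P (X i \<omega>)"
      using ae
    proof eventually_elim
      case (elim \<omega>)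
      have "W (X i \<omega>) \<noteq> 0" if "0 < G \<omega>"
      proof
        assume "W (X i \<omega>) = 0"
        hence "G \<omega> = 0" unfolding G_def using I i by (intro prod_zero) auto
        thus False using that by simp
      qed
      thus ?case using elim W01(1)[of "X i \<omega>"] G0[of \<omega>] by (cases "G \<omega> = 0") (auto simp: less_le)
    qed
    thus ?thesis unfolding N' by (subst AE_density) auto
  qed
  show "(\<Prod>i\<in>I. p i) * measure N A \<le> prob A" if [measurable]: "A \<in> sets M" for A
  proof -
    have P: "0 < (\<Prod>i\<in>I. p i)" using p by (intro prod_pos) auto
    have PG: "(\<Prod>i\<in>I. p i) * G \<omega> \<le> 1" for \<omega>
    proof -
      have "(\<Prod>i\<in>I. p i) * G \<omega> = (\<Prod>i\<in>I. W (X i \<omega>))"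
        unfolding G_def prod.distrib[symmetric]
      proof (rule prod.cong)
        fix i assume "i \<in> I"
        from p(2)[OF this] show "p i * (W (X i \<omega>) / p i) = W (X i \<omega>)" by simp
      qed simp
      also have "\<dots> \<le> 1" using W01 by (intro prod_le_1) auto
      finally show ?thesis .
    qed
    have "measure N A = integral\<^sup>L N (indicator A)" by simp
    also have "\<dots> = expectation (\<lambda>\<omega>. G \<omega> * indicator A \<omega>)"
      unfolding N' by (subst integral_density) (auto simp: G0)
    finally have "(\<Prod>i\<in>I. p i) * measure N A = expectation (\<lambda>\<omega>. (\<Prod>i\<in>I. p i) * (G \<omega> * indicator A \<omega>))"
      by simp
    also have "\<dots> \<le> expectation (indicator A)"
    proof (rule integral_mono)
      show "(\<Prod>i\<in>I. p i) * (G \<omega> * indicator A \<omega>) \<le> indicator A \<omega>" for \<omega>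
        using PG[of \<omega>] by (auto simp: indicator_def)
      show "integrable M (indicator A :: 'a \<Rightarrow> real)"
        by (rule integrable_const_bound[where B = 1]) auto
      show "integrable M (\<lambda>\<omega>. (\<Prod>i\<in>I. p i) * (G \<omega> * indicator A \<omega>))"
        using PG P G0 by (intro integrable_const_bound[where B = 1]) (auto simp: indicator_def)
    qed
    finally show ?thesis by simp
  qed
qed

text \<open>A continuous version of the indicator of \<open>x \<le> R - 1\<close>: the moments of the truncated variables
  then depend continuously on \<open>R\<close> even in the presence of atoms.\<close>

definition ramp :: "real \<Rightarrow> real \<Rightarrow> real" where
  "ramp R x = min 1 (max 0 (2 * (R - 1 - x)))"

section \<open>Truncated moments as functions of the scale\<close>

lemma ramp_measurable [measurable]: "ramp R \<in> borel_measurable borel"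
  unfolding ramp_def by measurable

lemma ramp_01: "0 \<le> ramp R x" "ramp R x \<le> 1"
  by (auto simp: ramp_def)

lemma ramp_pos_imp: "0 < ramp R x \<Longrightarrow> x \<le> R - 1"
  by (auto simp: ramp_def min_def max_def split: if_splits)

lemma ramp_lt_1_imp: "ramp R x < 1 \<Longrightarrow> R - 3/2 \<le> x"
  by (auto simp: ramp_def min_def max_def split: if_splits)

lemma ramp_lipschitz: "\<bar>ramp R x - ramp R' x\<bar> \<le> 2 * \<bar>R - R'\<bar>"
  by (auto simp: ramp_def min_def max_def abs_if split: if_splits)

text \<open>The ramp vanishes above \<open>b\<close>, so a bound for \<open>f\<close> on
  \<open>[-1, b]\<close> suffices. One \<open>K\<close> serves all \<open>R \<le> b\<close>, as the
  continuity in \<open>R\<close> requires.\<close>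

lemma (in prob_space) integrable_ramp_times:
  assumes X [measurable]: "X \<in> borel_measurable M" and ge: "AE \<omega> in M. - 1 \<le> X \<omega>"
    and f [measurable]: "f \<in> borel_measurable borel"
    and K: "\<And>x. - 1 \<le> x \<Longrightarrow> x \<le> b \<Longrightarrow> \<bar>f x\<bar> \<le> K" and R: "R \<le> b" and b: "- 1 \<le> (b::real)"
  shows "integrable M (\<lambda>\<omega>. ramp R (X \<omega>) * f (X \<omega>))"
proof (rule integrable_const_bound[where B = K])
  have K0: "0 \<le> K" using K[of "-1"] b by linarith
  show "AE \<omega> in M. norm (ramp R (X \<omega>) * f (X \<omega>)) \<le> K"
    using ge
  proof eventually_elim
    case (elim \<omega>)
    show ?case
    proof (cases "ramp R (X \<omega>) = 0")
      case True thus ?thesis using K0 by simp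
    next
      case False
      hence "X \<omega> \<le> b" using ramp_pos_imp[of R "X \<omega>"] ramp_01(1)[of R "X \<omega>"] R by simp
      hence "\<bar>f (X \<omega>)\<bar> \<le> K" using K elim by simp
      thus ?thesis using ramp_01[of R "X \<omega>"] mult_mono[of "ramp R (X \<omega>)" 1 "\<bar>f (X \<omega>)\<bar>" K]
        by (simp add: abs_mult)
    qed
  qed
qed measurable

text \<open>The ramp changes with slope at most 2 in \<open>R\<close>, so the expectation is even
  Lipschitz with constant \<open>2 * K\<close>.\<close>

lemma (in prob_space) continuous_on_expectation_ramp_times:
  assumes X [measurable]: "X \<in> borel_measurable M" and ge: "AE \<omega> in M. - 1 \<le> X \<omega>"
    and f [measurable]: "f \<in> borel_measurable borel"
    and K: "\<And>x. - 1 \<le> x \<Longrightarrow> x \<le> b \<Longrightarrow> \<bar>f x\<bar> \<le> K" and b: "- 1 \<le> (b::real)"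
  shows "continuous_on {..b} (\<lambda>R. expectation (\<lambda>\<omega>. ramp R (X \<omega>) * f (X \<omega>)))"
proof (rule lipschitz_on_continuous_on)
  have K0: "0 \<le> K" using K[of "-1"] b by linarith
  note int = integrable_ramp_times[OF X ge f K _ b]
  show "(2 * K)-lipschitz_on {..b} (\<lambda>R. expectation (\<lambda>\<omega>. ramp R (X \<omega>) * f (X \<omega>)))"
  proof (rule lipschitz_onI)
    fix R R' assume R: "R \<in> {..b}" "R' \<in> {..b}"
    have "AE \<omega> in M. \<bar>ramp R (X \<omega>) * f (X \<omega>) - ramp R' (X \<omega>) * f (X \<omega>)\<bar> \<le> 2 * K * \<bar>R - R'\<bar>"
      using ge
    proof eventually_elim
      case (elim \<omega>)
      show ?case
      proof (cases "X \<omega> \<le> b")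
        case True
        have "\<bar>ramp R (X \<omega>) - ramp R' (X \<omega>)\<bar> * \<bar>f (X \<omega>)\<bar> \<le> 2 * \<bar>R - R'\<bar> * K"
          using ramp_lipschitz K[OF elim True] by (intro mult_mono) auto
        thus ?thesis unfolding left_diff_distrib[symmetric] abs_mult by (simp only: mult_ac)
      next
        case False
        hence "ramp R (X \<omega>) = 0" "ramp R' (X \<omega>) = 0"
          using R by (auto simp: ramp_def)
        thus ?thesis using K0 by simp
      qed
    qed
    hence "\<bar>expectation (\<lambda>\<omega>. ramp R (X \<omega>) * f (X \<omega>) - ramp R' (X \<omega>) * f (X \<omega>))\<bar> \<le> expectation (\<lambda>\<omega>. 2 * K * \<bar>R - R'\<bar>)"
      using int R by (intro order.trans[OF integral_abs_bound integral_mono_AE]) auto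
    thus "dist (expectation (\<lambda>\<omega>. ramp R (X \<omega>) * f (X \<omega>))) (expectation (\<lambda>\<omega>. ramp R' (X \<omega>) * f (X \<omega>))) \<le> 2 * K * dist R R'"
      using int R by (simp add: dist_real_def prob_space)
  qed (use K0 in simp)
qed

text \<open>The mass that the ramp removes lies above \<open>R - 3/2\<close>, and by mean zero it
  contributes exactly \<open>- e1\<close>; this ties the lost mass to the shift of the mean. The
  bound on \<open>e2\<close> comes from \<open>(x + 1) * (R - 1 - x) \<ge> 0\<close> where the ramp
  is positive.\<close>

lemma (in prob_space) ramp_moments:
  assumes X [measurable]: "X \<in> borel_measurable M" and ge: "AE \<omega> in M. - 1 \<le> X \<omega>"
    and intX: "integrable M X" and EX: "expectation X = 0" and R: "3/2 < R"
    and p: "p = expectation (\<lambda>\<omega>. ramp R (X \<omega>))"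
    and e1: "e1 = expectation (\<lambda>\<omega>. ramp R (X \<omega>) * X \<omega>)"
    and e2: "e2 = expectation (\<lambda>\<omega>. ramp R (X \<omega>) * (X \<omega>)\<^sup>2)"
  shows "0 < p" "0 \<le> - e1" "- e1 \<le> p" "(1 - p) * (R - 3/2) \<le> - e1"
    and "2 \<le> R \<Longrightarrow> e2 \<le> R * p"
proof -
  have i0: "integrable M (\<lambda>\<omega>. ramp R (X \<omega>))"
    using integrable_ramp_times[OF X ge, of "\<lambda>_. 1" R 1 R] R by simp
  have i1: "integrable M (\<lambda>\<omega>. ramp R (X \<omega>) * X \<omega>)"
    using integrable_ramp_times[OF X ge, of "\<lambda>x. x" R "1 + R" R] R by (simp add: abs_le_iff)
  have i2: "integrable M (\<lambda>\<omega>. ramp R (X \<omega>) * (X \<omega>)\<^sup>2)"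
  proof (rule integrable_ramp_times[OF X ge, of "\<lambda>x. x\<^sup>2" R "(1 + R)\<^sup>2" R])
    show "\<bar>x\<^sup>2\<bar> \<le> (1 + R)\<^sup>2" if "- 1 \<le> x" "x \<le> R" for x
    proof -
      have "\<bar>x\<bar> \<le> \<bar>1 + R\<bar>" using that R by linarith
      thus ?thesis by (simp add: abs_le_square_iff)
    qed
  qed (use R in auto)
  have E1: "expectation (\<lambda>\<omega>. (1 - ramp R (X \<omega>)) * X \<omega>) = - e1"
    using i1 intX by (simp add: left_diff_distrib e1 EX)
  have "expectation (\<lambda>\<omega>. (1 - ramp R (X \<omega>)) * (R - 3/2)) \<le> expectation (\<lambda>\<omega>. (1 - ramp R (X \<omega>)) * X \<omega>)"
  proof (rule integral_mono)
    show "(1 - ramp R (X \<omega>)) * (R - 3/2) \<le> (1 - ramp R (X \<omega>)) * X \<omega>" for \<omega>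
      using ramp_01(2)[of R "X \<omega>"] ramp_lt_1_imp[of R "X \<omega>"]
      by (cases "ramp R (X \<omega>) = 1") (auto intro!: mult_left_mono)
    show "integrable M (\<lambda>\<omega>. (1 - ramp R (X \<omega>)) * X \<omega>)"
      using i1 intX by (simp add: left_diff_distrib)
  qed (use i0 in simp)
  thus low: "(1 - p) * (R - 3/2) \<le> - e1" unfolding E1 using i0 by (simp add: p prob_space)
  have "expectation (\<lambda>\<omega>. - ramp R (X \<omega>)) \<le> e1"
    unfolding e1
  proof (rule integral_mono_AE)
    show "AE \<omega> in M. - ramp R (X \<omega>) \<le> ramp R (X \<omega>) * X \<omega>"
      using ge
    proof eventually_elim
      case (elim \<omega>)
      from mult_left_mono[OF this ramp_01(1)[of R "X \<omega>"]] show ?case by simp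
    qed
  qed (use i0 i1 in auto)
  thus up: "- e1 \<le> p" by (simp add: p)
  have "expectation (\<lambda>\<omega>. ramp R (X \<omega>)) \<le> expectation (\<lambda>\<omega>. 1)"
    using i0 ramp_01(2) by (intro integral_mono) auto
  hence p1: "p \<le> 1" by (simp add: p prob_space)
  have "0 \<le> (1 - p) * (R - 3/2)" using p1 R by simp
  thus "0 \<le> - e1" using low by linarith
  \<comment> \<open>Otherwise the removed mass alone would force
    \<open>R - 3/2 \<le> - e1 \<le> p \<le> 0\<close>.\<close>
  show "0 < p"
  proof (rule ccontr)
    assume "\<not> 0 < p"
    hence "R - 3/2 \<le> (1 - p) * (R - 3/2)" using R by simp
    thus False using low up R \<open>\<not> 0 < p\<close> by linarith
  qed
  show "e2 \<le> R * p" if "2 \<le> R"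
  proof -
    have "e2 \<le> expectation (\<lambda>\<omega>. (R - 2) * (ramp R (X \<omega>) * X \<omega>) + (R - 1) * ramp R (X \<omega>))"
      unfolding e2
    proof (rule integral_mono_AE)
      show "AE \<omega> in M. ramp R (X \<omega>) * (X \<omega>)\<^sup>2 \<le> (R - 2) * (ramp R (X \<omega>) * X \<omega>) + (R - 1) * ramp R (X \<omega>)"
        using ge
      proof eventually_elim
        case (elim \<omega>)
        have "0 \<le> ramp R (X \<omega>) * ((X \<omega> + 1) * (R - 1 - X \<omega>))"
        proof (cases "ramp R (X \<omega>) = 0")
          case False
          hence "X \<omega> \<le> R - 1" using ramp_pos_imp[of R "X \<omega>"] ramp_01(1)[of R "X \<omega>"] by simp
          thus ?thesis using elim ramp_01(1) by (intro mult_nonneg_nonneg) auto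
        qed simp
        thus ?case by (simp add: power2_eq_square algebra_simps)
      qed
    qed (use i0 i1 i2 in auto)
    also have "\<dots> = (R - 2) * e1 + (R - 1) * p" using i0 i1 by (simp add: e1 p)
    also have "\<dots> \<le> (R - 2) * 0 + R * p"
      using \<open>0 \<le> - e1\<close> \<open>0 < p\<close> that by (intro add_mono mult_left_mono mult_right_mono) auto
    finally show ?thesis by simp
  qed
qed

subsection \<open>The main bound\<close>

lemma (in prob_space) feige_bound:
  fixes X :: "'i \<Rightarrow> 'a \<Rightarrow> real"
  assumes I: "finite I" and indep: "indep_vars (\<lambda>_. borel) X I"
    and int: "\<And>i. i \<in> I \<Longrightarrow> integrable M (X i)"
    and mean: "\<And>i. i \<in> I \<Longrightarrow> expectation (X i) = 0"
    and ge: "\<And>i. i \<in> I \<Longrightarrow> AE \<omega> in M. - 1 \<le> X i \<omega>"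
  shows "1798/10000 \<le> prob {\<omega> \<in> space M. (\<Sum>i\<in>I. X i \<omega>) \<le> 1}"
proof -
  have rv [measurable]: "X i \<in> borel_measurable M" if "i \<in> I" for i
    using int that by auto
  define p where "p R i = expectation (\<lambda>\<omega>. ramp R (X i \<omega>))" for R i
  define e1 where "e1 R i = expectation (\<lambda>\<omega>. ramp R (X i \<omega>) * X i \<omega>)" for R i
  define e2 where "e2 R i = expectation (\<lambda>\<omega>. ramp R (X i \<omega>) * (X i \<omega>)\<^sup>2)" for R i
  have mom: "0 < p R i" "0 \<le> - e1 R i" "- e1 R i \<le> p R i" "(1 - p R i) * (R - 3/2) \<le> - e1 R i"
    "2 \<le> R \<Longrightarrow> e2 R i \<le> R * p R i" if "i \<in> I" "3/2 < R" for i R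
    using ramp_moments[OF rv ge int mean that(2) p_def e1_def e2_def] that(1) by auto
  have ratio: "e1 R i / p R i \<le> 0" if "i \<in> I" "3/2 < R" for i R
    using mom(1,2)[OF that] by (intro divide_nonpos_pos) auto
  have sq_le: "\<bar>x\<^sup>2\<bar> \<le> (1 + \<bar>b\<bar>)\<^sup>2" if "- 1 \<le> x" "x \<le> b" for x b :: real
  proof -
    have "\<bar>x\<bar> \<le> 1 + \<bar>b\<bar>" using that by linarith
    from power_mono[OF this, of 2] show ?thesis by simp
  qed
  define D where "D R = 1 - (\<Sum>i\<in>I. e1 R i / p R i)" for R
  define V where "V R = (\<Sum>i\<in>I. e2 R i / p R i - (e1 R i / p R i)\<^sup>2)" for R
  define n where "n = real (card I)"
  \<comment> \<open>An upper end for the scale: \<open>D b \<le> 1 + n\<close> and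
    \<open>V b \<le> n * b\<close> then satisfy both constraints, and \<open>b \<ge> 2\<close>
    admits the second moment bound.\<close>
  define b where "b = 2 * n + 2"
  have b: "2 \<le> b" by (simp add: b_def n_def)
  \<comment> \<open>The maximum merges both constraints, so one application of the intermediate
    value theorem makes both hold with one of them tight.\<close>
  define g where "g R = max (D R - 65/100 * R) (V R - 14/10 * R\<^sup>2)" for R
  have cont: "continuous_on {20/13..b} (\<lambda>R. p R i)" "continuous_on {20/13..b} (\<lambda>R. e1 R i)"
    "continuous_on {20/13..b} (\<lambda>R. e2 R i)" if i: "i \<in> I" for i
  proof -
    show "continuous_on {20/13..b} (\<lambda>R. p R i)"
      using continuous_on_expectation_ramp_times[OF rv[OF i] ge[OF i], of "\<lambda>_. 1" b 1] b
      unfolding p_def by (auto intro: continuous_on_subset)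
    show "continuous_on {20/13..b} (\<lambda>R. e1 R i)"
      using continuous_on_expectation_ramp_times[OF rv[OF i] ge[OF i], of "\<lambda>x. x" b "1 + b"] b
      unfolding e1_def by (auto intro: continuous_on_subset simp: abs_le_iff)
    show "continuous_on {20/13..b} (\<lambda>R. e2 R i)"
      unfolding e2_def
    proof (rule continuous_on_subset)
      show "continuous_on {..b} (\<lambda>R. expectation (\<lambda>\<omega>. ramp R (X i \<omega>) * (X i \<omega>)\<^sup>2))"
        using b by (intro continuous_on_expectation_ramp_times[OF rv[OF i] ge[OF i] _ sq_le]) auto
    qed auto
  qed
  have "p R i \<noteq> 0" if "i \<in> I" "R \<in> {20/13..b}" for i R
    using mom(1)[OF that(1), of R] that(2) by auto
  hence "continuous_on {20/13..b} g"
    unfolding g_def D_def V_def using cont by (intro continuous_intros) auto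
  \<comment> \<open>The lower end is \<open>1 / 0.65\<close>, where \<open>D \<ge> 1\<close> already
    gives the sign; it also exceeds the \<open>3/2\<close> that the moment bounds require.\<close>
  moreover have "0 \<le> g (20/13)"
  proof -
    have "(\<Sum>i\<in>I. e1 (20/13) i / p (20/13) i) \<le> 0"
      using ratio[of _ "20/13"] by (intro sum_nonpos) auto
    thus ?thesis by (simp add: g_def D_def)
  qed
  moreover have "g b \<le> 0"
  proof -
    have "- e1 b i / p b i \<le> 1" if "i \<in> I" for i
      using mom(1,3)[OF that, of b] b by (simp only: pos_divide_le_eq mult_1)
    hence "(\<Sum>i\<in>I. - (e1 b i / p b i)) \<le> (\<Sum>i\<in>I. 1)"
      by (intro sum_mono) (simp only: minus_divide_left)
    hence "D b \<le> 1 + n" by (simp add: D_def n_def sum_negf)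
    hence "D b \<le> 65/100 * b" by (simp add: b_def n_def)
    moreover have "e2 b i / p b i - (e1 b i / p b i)\<^sup>2 \<le> b" if "i \<in> I" for i
    proof -
      have "e2 b i / p b i \<le> b" using mom(1,5)[OF that, of b] b by (simp add: divide_le_eq)
      moreover have "0 \<le> (e1 b i / p b i)\<^sup>2" by simp
      ultimately show ?thesis by linarith
    qed
    hence "V b \<le> (\<Sum>i\<in>I. b)" unfolding V_def by (intro sum_mono)
    hence "V b \<le> n * b" by (simp add: n_def)
    moreover have "n * b \<le> 14/10 * b\<^sup>2"
      using b mult_right_mono[of n "14/10 * b" b] by (simp add: b_def n_def power2_eq_square)
    ultimately show ?thesis by (simp add: g_def)
  qed
  ultimately obtain R where R: "20/13 \<le> R" "g R = 0"
    using IVT2'[of g b 0 "20/13"] b by auto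
  have R0: "3/2 < R" "0 < R" using R(1) by auto
  note mom = mom[OF _ R0(1)]
  have DV: "D R \<le> 65/100 * R" "V R \<le> 14/10 * R\<^sup>2" "D R = 65/100 * R \<or> V R = 14/10 * R\<^sup>2"
    using R(2) by (auto simp: g_def max_def split: if_splits)
  have D1: "1 \<le> D R"
  proof -
    have "(\<Sum>i\<in>I. e1 R i / p R i) \<le> 0"
      using ratio R0 by (intro sum_nonpos) auto
    thus ?thesis by (simp add: D_def)
  qed

  \<comment> \<open>The reweighted measure at the chosen scale\<close>
  define N where "N = density M (\<lambda>\<omega>. ennreal (\<Prod>i\<in>I. ramp R (X i \<omega>) / p R i))"
  have pos: "\<forall>i\<in>I. 0 < p R i" using mom(1) by blast
  note tilt = product_density[OF I indep ramp_measurable ramp_01 p_def pos N_def]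
  interpret N: prob_space N by (rule tilt(1))
  have E1: "N.expectation (X i) = e1 R i / p R i" if i: "i \<in> I" for i
    unfolding e1_def
    using integrable_ramp_times[OF rv[OF i] ge[OF i], of "\<lambda>x. x" R "1 + R" R] R0 tilt(3)[OF i, of "\<lambda>x. x"]
    by (simp add: abs_le_iff)
  have E2: "N.expectation (\<lambda>\<omega>. (X i \<omega>)\<^sup>2) = e2 R i / p R i" if i: "i \<in> I" for i
    unfolding e2_def
    using R0 by (intro tilt(3)[OF i, of "\<lambda>x. x\<^sup>2"] integrable_ramp_times[OF rv[OF i] ge[OF i] _ sq_le order_refl]) auto
  have bd: "AE \<omega> in N. - 1 \<le> X i \<omega> \<and> X i \<omega> \<le> R - 1" if i: "i \<in> I" for i
  proof (rule tilt(4)[OF i])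
    show "AE \<omega> in M. 0 < ramp R (X i \<omega>) \<longrightarrow> - 1 \<le> X i \<omega> \<and> X i \<omega> \<le> R - 1"
      using ge[OF i] by eventually_elim (auto dest: ramp_pos_imp)
  qed simp
  define Q where "Q = N.prob {\<omega> \<in> space N. (\<Sum>i\<in>I. X i \<omega>) \<le> 1}"
  have DR: "D R = 1 - (\<Sum>i\<in>I. N.expectation (X i))" by (simp add: D_def E1)
  have VR: "V R = (\<Sum>i\<in>I. N.expectation (\<lambda>\<omega>. (X i \<omega>)\<^sup>2) - (N.expectation (X i))\<^sup>2)"
    by (simp add: V_def E1 E2)
  have "0 < D R" using D1 by simp
  note bounds = N.indep_sum_bounds[OF I tilt(2) R0(2) bd DR this VR, folded Q_def]
  \<comment> \<open>The factor \<open>exp (D R / R)\<close> is what the return to the original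
    measure will cost.\<close>
  have "1798/10000 * exp (D R / R) \<le> Q"
  proof (cases "V R = 14/10 * R\<^sup>2")
    case True
    hence v: "V R / R\<^sup>2 = 14/10" using R0 by simp
    have "0 \<le> D R / R" "D R / R \<le> 65/100"
      using D1 DV(1) R0 by (simp_all add: pos_divide_le_eq)
    from char_bound_ge_large_variance[OF this] show ?thesis
      using bounds(2) unfolding v by linarith
  next
    case False
    hence D: "D R = 65/100 * R" using DV(3) by simp
    hence a: "D R / R = 65/100" using R0 by simp
    define v where "v = V R / R\<^sup>2"
    have v: "0 \<le> v" "v \<le> 14/10" using bounds(3) DV(2) R0 by (simp_all add: v_def pos_divide_le_eq)
    show ?thesis
    proof (cases "v \<le> 8/10")
      case True
      have "V R = v * R\<^sup>2" using R0 by (simp add: v_def)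
      hence "(D R)\<^sup>2 / ((D R)\<^sup>2 + V R) = (R\<^sup>2 * (65/100)\<^sup>2) / (R\<^sup>2 * ((65/100)\<^sup>2 + v))"
        by (simp only: D power_mult_distrib distrib_left mult.commute)
      also have "\<dots> = (65/100)\<^sup>2 / ((65/100)\<^sup>2 + v)" using R0 by (subst mult_divide_mult_cancel_left) auto
      finally show ?thesis using cantelli_bound_ge[OF v(1) True] bounds(1) unfolding a by linarith
    next
      case False
      thus ?thesis using char_bound_ge_medium_variance[of v] v bounds(2)
        unfolding a v_def[symmetric] by linarith
    qed
  qed
  moreover have "exp (- (D R / R)) \<le> (\<Prod>i\<in>I. p R i)"
  proof -
    define q where "q = R - 3/2"
    have q: "0 < q" using R0 by (simp add: q_def)
    \<comment> \<open>The link between lost mass and shifted mean reads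
      \<open>1 \<le> p * (1 + m / q)\<close>, with \<open>- m\<close> the reweighted mean; then
      \<open>1 + x \<le> exp x\<close> applies. The means add up to \<open>1 - D R\<close> over all
      indices.\<close>
    have "exp (e1 R i / p R i / q) \<le> p R i" if i: "i \<in> I" for i
    proof -
      have p0: "0 < p R i" using mom(1)[OF i] .
      define m where "m = - (e1 R i / p R i)"
      have "0 \<le> m" using ratio[OF i R0(1)] by (simp only: m_def neg_0_le_iff_le)
      have "(1 - p R i) * q \<le> p R i * m"
        using mom(4)[OF i] p0 by (simp add: m_def q_def)
      hence "1 \<le> p R i * (1 + m / q)" using q by (simp add: field_simps)
      also have "\<dots> \<le> p R i * exp (m / q)" using p0 by (intro mult_left_mono exp_ge_add_one_self) auto
      finally have "exp (- (m / q)) \<le> p R i" by (simp add: exp_minus field_simps)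
      thus ?thesis by (simp add: m_def)
    qed
    hence "(\<Prod>i\<in>I. exp (e1 R i / p R i / q)) \<le> (\<Prod>i\<in>I. p R i)"
      by (intro prod_mono) auto
    moreover have "- ((D R - 1) / q) = (\<Sum>i\<in>I. e1 R i / p R i / q)"
      by (simp only: sum_divide_distrib[symmetric]) (simp add: D_def)
    ultimately have "exp (- ((D R - 1) / q)) \<le> (\<Prod>i\<in>I. p R i)"
      by (simp only: exp_sum[OF I])
    \<comment> \<open>The claim amounts to \<open>3/2 * D R \<le> R\<close>, which holds because
      \<open>0.65 < 2/3\<close>: the gain of 1 in the numerator pays for the \<open>3/2\<close> lost
      in the denominator.\<close>
    moreover have "(D R - 1) / q \<le> D R / R"
    proof -
      have "(D R - 1) * R \<le> D R * q" using DV(1) D1 R0 by (simp add: q_def algebra_simps)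
      thus ?thesis using q R0 by (simp add: divide_simps)
    qed
    ultimately show ?thesis by (meson exp_le_cancel_iff neg_le_iff_le order_trans)
  qed
  ultimately have "exp (- (D R / R)) * (1798/10000 * exp (D R / R)) \<le> (\<Prod>i\<in>I. p R i) * Q"
    using pos by (intro mult_mono prod_nonneg) (auto intro: less_imp_le)
  moreover have "exp (- (D R / R)) * (1798/10000 * exp (D R / R)) = 1798/10000"
    by (simp add: exp_minus)
  ultimately have "1798/10000 \<le> (\<Prod>i\<in>I. p R i) * Q" by (simp only:)
  also have "space N = space M" by (simp add: N_def)
  hence "(\<Prod>i\<in>I. p R i) * Q \<le> prob {\<omega> \<in> space M. (\<Sum>i\<in>I. X i \<omega>) \<le> 1}"
    unfolding Q_def by (simp only:) (intro tilt(5), measurable)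
  finally show ?thesis .
qed

theorem theorem4p4:
  fixes M :: "'a measure" and X :: "nat \<Rightarrow> 'a \<Rightarrow> real" and n :: nat
  assumes "prob_space M"
    and "n \<ge> 1"
    and "prob_space.indep_vars M (\<lambda>_. borel) X {1..n}"
    and "\<And>i. i \<in> {1..n} \<Longrightarrow> integrable M (X i)"
    and "\<And>i. i \<in> {1..n} \<Longrightarrow> (LINT \<omega>|M. X i \<omega>) = 0"
    and "\<And>i. i \<in> {1..n} \<Longrightarrow> (AE \<omega> in M. X i \<omega> \<ge> -1)"
  shows "\<P>(\<omega> in M. (\<Sum>i=1..n. X i \<omega>) \<le> 1) \<ge> 0.1798"
proof -
  interpret prob_space M by fact
  from feige_bound[OF finite_atLeastAtMost assms(3-6)] show ?thesis by simp
qed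

end
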